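(* Fix a positive rational $s$. There exists a constant $C(s)>0$ such that for every $n$, every connected graph $G=(V,E,(r_e)_{e\in E})$ on $n$ vertices with positive edge weights, and every integer $m\ge 2$, \[ \forall\,\varepsilon\in(0,1/4):\qquad t_{\mathrm{mix}}^{\mathrm{BB}(G,s,m)}(\varepsilon)\le C(s)\,\log\!\Big(\frac{n+m}{\varepsilon}\Big)\,\max_{i,j}\mathbb E\,\hat M_{i,j}(G). \] Moreover, writing $s=b/a$ with $a,b$ coprime positive integers, one may take $C(s)=C'\,a\,(p^* )^{-2}\log\big(12a(p^* )^{-2}\big)\log(a+b)$ for a universal constant $C'>0$, where $p^*=(5/12)^{2s}/(6B(s,s))$ if $s<20$ and $p^*=\frac16\big(1-\frac{20}{s+1}\big)$ if $s\ge 20$, with $B(\cdot,\cdot)$ the beta function.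
   Context: Let $G=(V,E,(r_e)_{e\in E})$ be a finite connected graph with vertex set $V=\{1,\dots,n\}$, edge set $E$ and edge weights $r_e>0$. For $s>0$ and an integer $m\ge0$ let $\Omega_{G,m}=\{\xi\in\mathbb N_0^V:\sum_{v\in V}\xi(v)=m\}$. The $m$-particle symmetric beta-binomial splitting process $\mathrm{BB}(G,s,m)$ is the continuous-time Markov chain on $\Omega_{G,m}$ with generator $\mathcal L f=\sum_{e\in E}\frac{r_e}{\sum_{e'\in E}r_{e'}}(\mathcal P_e f-f)$, where for $e=\{v,w\}$, $\mathcal P_ef(\xi)=\mathbb E[f(\xi')]$ with $\xi'(v)=X$, $\xi'(w)=\xi(v)+\xi(w)-X$, $\xi'(u)=\xi(u)$ for $u\notin e$, and $X\sim\mathrm{BetaBin}(\xi(v)+\xi(w),s,s)$, i.e. $\mathbb P(X=k)=\binom{N}{k}\frac{B(k+s,N-k+s)}{B(s,s)}$ for $N=\xi(v)+\xi(w)$, $0\le k\le N$. For an irreducible Markov process with equilibrium $\pi$ on a finite set, $t_{\mathrm{mix}}(\varepsilon)=\inf\{t\ge0:\max_{\xi_0}\|\mathcal L(\xi_t)-\pi\|_{\mathrm{TV}}\le\varepsilon\}$, where $\|\mu-\nu\|_{\mathrm{TV}}=\sum_\omega(\mu(\omega)-\nu(\omega))_+$; $t^{\mathrm{BB}(G,s,m)}_{\mathrm{mix}}$ denotes this for $\mathrm{BB}(G,s,m)$. For distinct $i,j\in V$, $\hat M_{i,j}(G)$ is the meeting time $\inf\{t\ge0:X_t=Y_t\}$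 of two independent continuous-time random walks $X,Y$ on $V$ with $X_0=i$, $Y_0=j$, each jumping from its current vertex $v$ to $w$ at rate $r_{\{v,w\}}/(2\sum_{e\in E}r_e)$ for every edge $\{v,w\}\in E$ (i.e. each moves as the single particle of $\mathrm{BB}(G,s,1)$). The maximum is over distinct $i,j\in V$. *)

theory Defs
  imports "HOL-Analysis.Analysis"
begin

section \<open>Finite continuous-time Markov chains (analytic description)\<close>

text \<open>Powers of a matrix indexed by a finite state set S.\<close>
fun mpow :: "'a set \<Rightarrow> ('a \<Rightarrow> 'a \<Rightarrow> real) \<Rightarrow> nat \<Rightarrow> 'a \<Rightarrow> 'a \<Rightarrow> real" where
  "mpow S Q 0 x y = (if x = y then 1 else 0)"
| "mpow S Q (Suc k) x y = (\<Sum>z\<in>S. Q x z * mpow S Q k z y)"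

text \<open>Matrix exponential exp(tQ); for a generator Q this is the transition
  semigroup, i.e. expm S Q t x y = P(X_t = y | X_0 = x).\<close>
definition expm :: "'a set \<Rightarrow> ('a \<Rightarrow> 'a \<Rightarrow> real) \<Rightarrow> real \<Rightarrow> 'a \<Rightarrow> 'a \<Rightarrow> real" where
  "expm S Q t x y = (\<Sum>k. t ^ k / fact k * mpow S Q k x y)"

definition tv_dist :: "'a set \<Rightarrow> ('a \<Rightarrow> real) \<Rightarrow> ('a \<Rightarrow> real) \<Rightarrow> real" where
  "tv_dist S \<mu> \<nu> = (\<Sum>x\<in>S. max 0 (\<mu> x - \<nu> x))"

definition is_stationary :: "'a set \<Rightarrow> ('a \<Rightarrow> 'a \<Rightarrow> real) \<Rightarrow> ('a \<Rightarrow> real) \<Rightarrow> bool" where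
  "is_stationary S Q \<pi> \<longleftrightarrow> (\<forall>x\<in>S. \<pi> x \<ge> 0) \<and> (\<forall>x. x \<notin> S \<longrightarrow> \<pi> x = 0)
     \<and> (\<Sum>x\<in>S. \<pi> x) = 1 \<and> (\<forall>y\<in>S. (\<Sum>x\<in>S. \<pi> x * Q x y) = 0)"

text \<open>The equilibrium (unique stationary distribution of an irreducible chain).\<close>
definition equilibrium :: "'a set \<Rightarrow> ('a \<Rightarrow> 'a \<Rightarrow> real) \<Rightarrow> 'a \<Rightarrow> real" where
  "equilibrium S Q = (THE \<pi>. is_stationary S Q \<pi>)"

definition tmix :: "'a set \<Rightarrow> ('a \<Rightarrow> 'a \<Rightarrow> real) \<Rightarrow> real \<Rightarrow> real" where
  "tmix S Q \<epsilon> = Inf {t. t \<ge> 0 \<and>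
      (\<forall>x0\<in>S. tv_dist S (expm S Q t x0) (equilibrium S Q) \<le> \<epsilon>)}"

section \<open>Weighted graphs on V = {1..n}\<close>

definition weighted_conn_graph :: "nat \<Rightarrow> nat set set \<Rightarrow> (nat set \<Rightarrow> real) \<Rightarrow> bool" where
  "weighted_conn_graph n E r \<longleftrightarrow>
     (\<forall>e\<in>E. e \<subseteq> {1..n} \<and> card e = 2) \<and> (\<forall>e\<in>E. r e > 0) \<and>
     (\<forall>u\<in>{1..n}. \<forall>v\<in>{1..n}. (u, v) \<in> {(x, y). {x, y} \<in> E}\<^sup>*)"

definition total_weight :: "nat set set \<Rightarrow> (nat set \<Rightarrow> real) \<Rightarrow> real" where
  "total_weight E r = (\<Sum>e\<in>E. r e)"

section \<open>Beta-binomial splitting process BB(G,s,m)\<close>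

definition betabin :: "nat \<Rightarrow> real \<Rightarrow> nat \<Rightarrow> real" where
  "betabin N s k = (if k \<le> N then real (N choose k) * Beta (real k + s) (real (N - k) + s) / Beta s s
                    else 0)"

definition config_space :: "nat \<Rightarrow> nat \<Rightarrow> (nat \<Rightarrow> nat) set" where
  "config_space n m = {\<xi>. (\<forall>u. u \<notin> {1..n} \<longrightarrow> \<xi> u = 0) \<and> (\<Sum>v\<in>{1..n}. \<xi> v) = m}"

text \<open>Transition kernel P_e for e = {v,w}, with v = Min e, w = Max e.\<close>
definition split_kernel :: "real \<Rightarrow> nat set \<Rightarrow> (nat \<Rightarrow> nat) \<Rightarrow> (nat \<Rightarrow> nat) \<Rightarrow> real" where
  "split_kernel s e \<xi> \<eta> =
    (let v = Min e; w = Max e; N = \<xi> v + \<xi> w in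
     if (\<forall>u. u \<notin> e \<longrightarrow> \<eta> u = \<xi> u) \<and> \<eta> v + \<eta> w = N then betabin N s (\<eta> v) else 0)"

text \<open>Generator matrix: L f = sum_e r_e/R (P_e f - f).\<close>
definition BB_gen :: "nat set set \<Rightarrow> (nat set \<Rightarrow> real) \<Rightarrow> real \<Rightarrow> (nat \<Rightarrow> nat) \<Rightarrow> (nat \<Rightarrow> nat) \<Rightarrow> real" where
  "BB_gen E r s \<xi> \<eta> = (\<Sum>e\<in>E. r e / total_weight E r *
       (split_kernel s e \<xi> \<eta> - (if \<xi> = \<eta> then 1 else 0)))"

definition tmix_BB :: "nat \<Rightarrow> nat set set \<Rightarrow> (nat set \<Rightarrow> real) \<Rightarrow> real \<Rightarrow> nat \<Rightarrow> real \<Rightarrow> real" where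
  "tmix_BB n E r s m \<epsilon> = tmix (config_space n m) (BB_gen E r s) \<epsilon>"

section \<open>Meeting time of two independent random walks\<close>

text \<open>Generator of a single walker: jumps v -> w at rate r_{v,w}/(2R).\<close>
definition walk_gen :: "nat \<Rightarrow> nat set set \<Rightarrow> (nat set \<Rightarrow> real) \<Rightarrow> nat \<Rightarrow> nat \<Rightarrow> real" where
  "walk_gen n E r x y =
     (if x \<noteq> y then (if {x, y} \<in> E then r {x, y} / (2 * total_weight E r) else 0)
      else - (\<Sum>z\<in>{1..n} - {x}. if {x, z} \<in> E then r {x, z} / (2 * total_weight E r) else 0))"

text \<open>Generator of the pair (X,Y) of independent walkers.\<close>
definition pair_gen :: "nat \<Rightarrow> nat set set \<Rightarrow> (nat set \<Rightarrow> real) \<Rightarrow> nat \<times> nat \<Rightarrow> nat \<times> nat \<Rightarrow> real" where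
  "pair_gen n E r p q =
     walk_gen n E r (fst p) (fst q) * (if snd p = snd q then 1 else 0)
   + (if fst p = fst q then 1 else 0) * walk_gen n E r (snd p) (snd q)"

definition off_diag :: "nat \<Rightarrow> (nat \<times> nat) set" where
  "off_diag n = {(x, y). x \<in> {1..n} \<and> y \<in> {1..n} \<and> x \<noteq> y}"

text \<open>P(M_{i,j} > t): the pair process killed on the diagonal, i.e. the
  semigroup of the generator restricted to off-diagonal states.\<close>
definition meet_tail :: "nat \<Rightarrow> nat set set \<Rightarrow> (nat set \<Rightarrow> real) \<Rightarrow> nat \<Rightarrow> nat \<Rightarrow> real \<Rightarrow> real" where
  "meet_tail n E r i j t = (\<Sum>q\<in>off_diag n. expm (off_diag n) (pair_gen n E r) t (i, j) q)"

text \<open>E[M_{i,j}] = integral over [0,\<infinity>) of P(M_{i,j} > t).\<close>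
definition exp_meet :: "nat \<Rightarrow> nat set set \<Rightarrow> (nat set \<Rightarrow> real) \<Rightarrow> nat \<Rightarrow> nat \<Rightarrow> ennreal" where
  "exp_meet n E r i j = (\<integral>\<^sup>+ t. ennreal (meet_tail n E r i j t) * indicator {0..} t \<partial>lborel)"

definition max_exp_meet :: "nat \<Rightarrow> nat set set \<Rightarrow> (nat set \<Rightarrow> real) \<Rightarrow> ennreal" where
  "max_exp_meet n E r = (SUP p\<in>off_diag n. exp_meet n E r (fst p) (snd p))"

section \<open>The bound\<close>

definition BB_mixing_bound :: "real \<Rightarrow> real \<Rightarrow> bool" where
  "BB_mixing_bound s C \<longleftrightarrow>
     (\<forall>n E r m \<epsilon>. weighted_conn_graph n E r \<longrightarrow> m \<ge> 2 \<longrightarrow> 0 < \<epsilon> \<longrightarrow> \<epsilon> < 1/4 \<longrightarrow>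
        ennreal (tmix_BB n E r s m \<epsilon>)
          \<le> ennreal (C * ln ((real n + real m) / \<epsilon>)) * max_exp_meet n E r)"

definition p_star :: "real \<Rightarrow> real" where
  "p_star s = (if s < 20 then (5/12) powr (2 * s) / (6 * Beta s s) else (1 - 20 / (s + 1)) / 6)"

definition C_of :: "real \<Rightarrow> nat \<Rightarrow> nat \<Rightarrow> real \<Rightarrow> real" where
  "C_of C' a b s = C' * real a * (p_star s) powr (-2) * ln (12 * real a * (p_star s) powr (-2))
                   * ln (real a + real b)"

end

theory Submission
  imports Defs
begin

text \<open>
  Given the rung edges and a Beta(s,s) variable for each ring, the particles of BB(G,s,m) move
  independently: a particle on the ringing edge goes to its first endpoint with the drawn
  probability. Run two systems with the same rings and the same Beta variables, pairing the
  particles; when both particles of a pair sit on the ringing edge, send them to the same endpoint.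
  Before that, each of them jumps across an edge \<open>e\<close> at rate \<open>r e / (2 R)\<close>, where \<open>R\<close> is the total
  weight, and two particles at the two ends of \<open>e\<close> coalesce at rate \<open>r e / R\<close>, which is also the
  rate at which independent walkers meet across \<open>e\<close>. Hence a pair coalesces exactly at the meeting
  time of two independent walkers, and the distance to equilibrium at time \<open>t\<close> is at most \<open>m\<close> times
  the largest tail of a meeting time. These tails decay geometrically on the scale of the largest
  expected meeting time, so the constant can be taken to be \<open>2 exp 1\<close> for all \<open>s\<close>; this is at most a
  universal multiple of the stated constant because \<open>p_star s \<le> 1\<close>.

  Pairs are treated one at a time, after replacing both chains by Poisson many steps of a
  discrete kernel, so that the coupling becomes an inequality between powers of two kernels.
\<close>

section \<open>Matrices and matrix exponentials\<close>

definition kernel_apply :: "'a set \<Rightarrow> ('a \<Rightarrow> 'a \<Rightarrow> real) \<Rightarrow> ('a \<Rightarrow> real) \<Rightarrow> 'a \<Rightarrow> real" where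
  "kernel_apply S P f x = (\<Sum>y\<in>S. P x y * f y)"

lemma kernel_apply_identity:
  assumes "finite S" "x \<in> S"
  shows "kernel_apply S (\<lambda>x y. if x = y then 1 else 0) f x = f x"
  using assms by (simp add: kernel_apply_def if_distrib[of "\<lambda>a. a * _"] cong: if_cong)

lemma kernel_apply_indicator:
  assumes "finite S" "y \<in> S"
  shows "kernel_apply S P (\<lambda>z. if z = y then 1 else 0) x = P x y"
  using assms by (simp add: kernel_apply_def if_distrib[of "\<lambda>a. _ * a"] cong: if_cong)

lemma kernel_apply_mpow_0:
  assumes "finite S" "x \<in> S"
  shows "kernel_apply S (mpow S Q 0) f x = f x"
  using assms by (simp add: kernel_apply_def if_distrib[of "\<lambda>a. a * _"] cong: if_cong)

lemma kernel_apply_mpow_Suc: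
  "kernel_apply S (mpow S Q (Suc k)) f x = kernel_apply S Q (kernel_apply S (mpow S Q k) f) x"
  unfolding kernel_apply_def mpow.simps sum_distrib_right sum_distrib_left mult.assoc
  by (rule sum.swap)

lemma mpow_add:
  assumes "finite S"
  shows "x \<in> S \<Longrightarrow> mpow S Q (i + j) x y = kernel_apply S (mpow S Q i) (\<lambda>z. mpow S Q j z y) x"
proof (induction i arbitrary: x)
  case 0
  then show ?case by (simp only: kernel_apply_mpow_0[OF assms] add_0)
next
  case (Suc i)
  then have "mpow S Q (Suc i + j) x y
      = kernel_apply S Q (kernel_apply S (mpow S Q i) (\<lambda>z. mpow S Q j z y)) x"
    by (simp add: kernel_apply_def)
  then show ?case by (simp only: kernel_apply_mpow_Suc)
qed

lemma sum_binomial_Suc: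
  fixes f :: "nat \<Rightarrow> 'a :: comm_semiring_1"
  shows "(\<Sum>j\<le>Suc k. of_nat (Suc k choose j) * f j)
    = (\<Sum>j\<le>k. of_nat (k choose j) * f (Suc j)) + (\<Sum>j\<le>k. of_nat (k choose j) * f j)"
proof -
  have "(\<Sum>j\<le>k. of_nat (k choose j) * f j) = (\<Sum>j\<le>Suc k. of_nat (k choose j) * f j)"
    by (simp add: binomial_eq_0)
  also have "\<dots> = f 0 + (\<Sum>j\<le>k. of_nat (k choose Suc j) * f (Suc j))"
    by (subst sum.atMost_Suc_shift) simp
  finally show ?thesis
    by (subst sum.atMost_Suc_shift) (simp add: sum.distrib distrib_left distrib_right ac_simps)
qed

lemma mpow_add_scalar:
  assumes "finite S"
    and shifted: "\<And>x y. x \<in> S \<Longrightarrow> y \<in> S \<Longrightarrow> Q x y = K x y + (if x = y then c else 0)"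
  shows "x \<in> S \<Longrightarrow> y \<in> S \<Longrightarrow>
    mpow S Q k x y = (\<Sum>j\<le>k. real (k choose j) * (c ^ (k - j) * mpow S K j x y))"
proof (induction k arbitrary: x)
  case (Suc k)
  let ?b = "\<lambda>j z. real (k choose j) * (c ^ (k - j) * mpow S K j z y)"
  let ?term = "\<lambda>j. c ^ (Suc k - j) * mpow S K j x y"
  have "mpow S Q (Suc k) x y
      = (\<Sum>z\<in>S. K x z * mpow S Q k z y) + (\<Sum>z\<in>S. (if x = z then c else 0) * mpow S Q k z y)"
    unfolding sum.distrib[symmetric] mpow.simps
    by (intro sum.cong refl) (simp add: shifted Suc.prems distrib_right)
  also have "(\<Sum>z\<in>S. (if x = z then c else 0) * mpow S Q k z y) = c * mpow S Q k x y"
    using Suc.prems by (simp add: assms(1) if_distrib[of "\<lambda>a. a * _"] cong: if_cong)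
  also have "\<dots> = (\<Sum>j\<le>k. c * ?b j x)"
    by (simp only: Suc sum_distrib_left)
  also have "\<dots> = (\<Sum>j\<le>k. real (k choose j) * ?term j)"
    by (intro sum.cong refl) (simp add: Suc_diff_le)
  also have "(\<Sum>z\<in>S. K x z * mpow S Q k z y) = (\<Sum>z\<in>S. \<Sum>j\<le>k. K x z * ?b j z)"
    by (simp add: Suc sum_distrib_left)
  also have "\<dots> = (\<Sum>j\<le>k. real (k choose j) * ?term (Suc j))"
    by (subst sum.swap) (simp add: sum_distrib_left algebra_simps)
  finally show ?case by (simp only: sum_binomial_Suc)
qed simp

lemma abs_mpow_le:
  assumes "finite S"
  shows "x \<in> S \<Longrightarrow> \<bar>mpow S Q k x y\<bar> \<le> (\<Sum>u\<in>S. \<Sum>z\<in>S. \<bar>Q u z\<bar>) ^ k"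
proof (induction k arbitrary: x)
  case (Suc k)
  let ?B = "\<Sum>u\<in>S. \<Sum>z\<in>S. \<bar>Q u z\<bar>"
  have "\<bar>mpow S Q (Suc k) x y\<bar> \<le> (\<Sum>z\<in>S. \<bar>Q x z\<bar> * \<bar>mpow S Q k z y\<bar>)"
    by (simp flip: abs_mult)
  also have "\<dots> \<le> (\<Sum>z\<in>S. \<bar>Q x z\<bar> * ?B ^ k)"
    using Suc.IH by (intro sum_mono mult_left_mono) auto
  also have "\<dots> = (\<Sum>z\<in>S. \<bar>Q x z\<bar>) * ?B ^ k"
    by (simp add: sum_distrib_right)
  also have "\<dots> \<le> ?B * ?B ^ k"
    using assms Suc.prems
    by (intro mult_right_mono zero_le_power sum_nonneg member_le_sum) auto
  finally show ?case by simp
qed simp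

lemma summable_norm_expm:
  assumes "finite S" "x \<in> S"
  shows "summable (\<lambda>k. norm (t ^ k / fact k * mpow S Q k x y))"
proof (rule summable_comparison_test')
  let ?B = "\<Sum>u\<in>S. \<Sum>z\<in>S. \<bar>Q u z\<bar>"
  show "summable (\<lambda>k. norm ((t * ?B) ^ k /\<^sub>R fact k))" by (rule summable_norm_exp)
  fix k :: nat
  have "\<bar>t\<bar> ^ k / fact k * \<bar>mpow S Q k x y\<bar> \<le> \<bar>t\<bar> ^ k / fact k * ?B ^ k"
    by (intro mult_left_mono abs_mpow_le assms) simp
  also have "\<dots> = norm ((t * ?B) ^ k /\<^sub>R fact k)"
    by (simp add: abs_mult power_mult_distrib power_abs divide_inverse sum_nonneg)
  finally show "norm (norm (t ^ k / fact k * mpow S Q k x y)) \<le> norm ((t * ?B) ^ k /\<^sub>R fact k)"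
    by (simp add: abs_mult power_abs)
qed

lemma expm_sums:
  assumes "finite S" "x \<in> S"
  shows "(\<lambda>k. t ^ k / fact k * mpow S Q k x y) sums expm S Q t x y"
  unfolding expm_def
  by (rule summable_sums[OF summable_norm_cancel[OF summable_norm_expm[OF assms]]])

lemma sum_binomial_fact:
  fixes t u :: real
  shows "(\<Sum>i\<le>k. t ^ i / fact i * (u ^ (k - i) / fact (k - i))) = (t + u) ^ k / fact k"
  unfolding binomial_ring sum_divide_distrib
  by (intro sum.cong refl) (simp add: binomial_fact)

lemma expm_add:
  assumes "finite S" "x \<in> S"
  shows "expm S Q (t + u) x y = kernel_apply S (expm S Q t) (\<lambda>z. expm S Q u z y) x"
proof -
  let ?a = "\<lambda>z k. t ^ k / fact k * mpow S Q k x z" and ?b = "\<lambda>z k. u ^ k / fact k * mpow S Q k z y"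
  let ?w = "\<lambda>k i. t ^ i / fact i * (u ^ (k - i) / fact (k - i))"
  have "(\<Sum>z\<in>S. \<Sum>i\<le>k. ?a z i * ?b z (k - i)) = (t + u) ^ k / fact k * mpow S Q k x y" for k
  proof -
    have "(\<Sum>z\<in>S. \<Sum>i\<le>k. ?a z i * ?b z (k - i))
        = (\<Sum>i\<le>k. ?w k i * kernel_apply S (mpow S Q i) (\<lambda>z. mpow S Q (k - i) z y) x)"
      by (subst sum.swap) (simp add: kernel_apply_def sum_distrib_left algebra_simps)
    also have "\<dots> = (\<Sum>i\<le>k. ?w k i * mpow S Q k x y)"
      by (intro sum.cong refl) (simp flip: mpow_add[OF assms])
    finally show ?thesis by (simp only: sum_binomial_fact flip: sum_distrib_right)
  qed
  moreover have "(\<lambda>k. \<Sum>z\<in>S. \<Sum>i\<le>k. ?a z i * ?b z (k - i))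
      sums (\<Sum>z\<in>S. (\<Sum>k. ?a z k) * (\<Sum>k. ?b z k))"
    by (intro sums_sum Cauchy_product_sums summable_norm_expm assms)
  ultimately show ?thesis
    by (simp add: sums_iff expm_def kernel_apply_def)
qed

lemma expm_add_scalar:
  assumes "finite S" "x \<in> S" "y \<in> S"
    and shifted: "\<And>x y. x \<in> S \<Longrightarrow> y \<in> S \<Longrightarrow> Q x y = K x y + (if x = y then c else 0)"
  shows "expm S Q t x y = exp (c * t) * expm S K t x y"
proof -
  let ?a = "\<lambda>k. t ^ k / fact k * mpow S K k x y" and ?b = "\<lambda>k. (c * t) ^ k /\<^sub>R fact k"
  have mpow_Q: "mpow S Q k x y = (\<Sum>j\<le>k. real (k choose j) * (c ^ (k - j) * mpow S K j x y))" for k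
    by (rule mpow_add_scalar) (use assms in auto)
  have "(\<Sum>i\<le>k. ?a i * ?b (k - i)) = t ^ k / fact k * mpow S Q k x y" for k
    unfolding mpow_Q sum_distrib_left
  proof (intro sum.cong refl)
    fix i assume "i \<in> {..k}"
    then have i_le_k: "i \<le> k" by simp
    have power_split: "t ^ k = t ^ i * t ^ (k - i)" using i_le_k by (simp flip: power_add)
    show "?a i * ?b (k - i) = t ^ k / fact k * (real (k choose i) * (c ^ (k - i) * mpow S K i x y))"
      unfolding power_split binomial_fact[OF i_le_k] by (simp add: divide_simps power_mult_distrib)
  qed
  with Cauchy_product[OF summable_norm_expm[OF assms(1,2), of t K y] summable_norm_exp[of "c * t"]]
  show ?thesis by (simp add: expm_def exp_def mult.commute)
qed

lemma stationary_expm: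
  assumes "finite S" "y \<in> S" and "\<And>y. y \<in> S \<Longrightarrow> (\<Sum>x\<in>S. \<pi> x * Q x y) = 0"
  shows "(\<Sum>x\<in>S. \<pi> x * expm S Q t x y) = \<pi> y"
proof -
  have "(\<Sum>x\<in>S. \<pi> x * mpow S Q k x y) = (if k = 0 then \<pi> y else 0)" for k
  proof (cases k)
    case 0
    then show ?thesis using assms(1,2) by (simp add: if_distrib[of "\<lambda>a. _ * a"] cong: if_cong)
  next
    case (Suc l)
    have "(\<Sum>x\<in>S. \<pi> x * mpow S Q (Suc l) x y) = (\<Sum>z\<in>S. (\<Sum>x\<in>S. \<pi> x * Q x z) * mpow S Q l z y)"
      by (simp add: sum_distrib_left sum_distrib_right mult.assoc) (rule sum.swap)
    then show ?thesis using Suc assms(3) by simp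
  qed
  moreover have "(\<Sum>x\<in>S. \<pi> x * (t ^ k / fact k * mpow S Q k x y))
      = t ^ k / fact k * (\<Sum>x\<in>S. \<pi> x * mpow S Q k x y)" for k
    by (simp only: sum_distrib_left mult.left_commute)
  ultimately have "(\<Sum>x\<in>S. \<pi> x * (t ^ k / fact k * mpow S Q k x y)) = (if k = 0 then \<pi> y else 0)" for k
    by (simp del: mpow.simps)
  moreover have "(\<lambda>k. \<Sum>x\<in>S. \<pi> x * (t ^ k / fact k * mpow S Q k x y))
      sums (\<Sum>x\<in>S. \<pi> x * expm S Q t x y)"
    by (intro sums_sum sums_mult expm_sums assms(1))
  ultimately show ?thesis
    using sums_unique2 sums_single[of 0 "\<lambda>_. \<pi> y"] by fastforce
qed

section \<open>Distance to equilibrium\<close>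

definition mixed_within :: "'a set \<Rightarrow> ('a \<Rightarrow> 'a \<Rightarrow> real) \<Rightarrow> real \<Rightarrow> real \<Rightarrow> bool" where
  "mixed_within S Q t \<delta> \<longleftrightarrow> (\<forall>x\<in>S. \<forall>y\<in>S. tv_dist S (expm S Q t x) (expm S Q t y) \<le> \<delta>)"

lemma tv_dist_self: "tv_dist S \<mu> \<mu> = 0"
  by (simp add: tv_dist_def)

lemma tv_dist_triangle: "tv_dist S \<mu> \<rho> \<le> tv_dist S \<mu> \<nu> + tv_dist S \<nu> \<rho>"
  unfolding tv_dist_def sum.distrib[symmetric] by (intro sum_mono) auto

lemma tv_dist_cong:
  assumes "\<And>x. x \<in> S \<Longrightarrow> \<mu> x = \<mu>' x" "\<And>x. x \<in> S \<Longrightarrow> \<nu> x = \<nu>' x"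
  shows "tv_dist S \<mu> \<nu> = tv_dist S \<mu>' \<nu>'"
  unfolding tv_dist_def using assms by (intro sum.cong) auto

lemma tv_dist_le_if_test_functions_le:
  fixes \<mu> \<nu> :: "'a \<Rightarrow> real"
  assumes "\<And>f. (\<And>y. f y \<in> {0..1}) \<Longrightarrow> \<bar>(\<Sum>y\<in>S. \<mu> y * f y) - (\<Sum>y\<in>S. \<nu> y * f y)\<bar> \<le> \<delta>"
  shows "tv_dist S \<mu> \<nu> \<le> \<delta>"
proof -
  let ?f = "\<lambda>y. if \<nu> y \<le> \<mu> y then 1 else (0::real)"
  have "tv_dist S \<mu> \<nu> = (\<Sum>y\<in>S. \<mu> y * ?f y) - (\<Sum>y\<in>S. \<nu> y * ?f y)"
    unfolding tv_dist_def sum_subtractf[symmetric] by (intro sum.cong refl) auto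
  also have "\<dots> \<le> \<delta>" by (rule order_trans[OF abs_ge_self assms]) auto
  finally show ?thesis .
qed

lemma tv_dist_mixture_le:
  assumes "\<And>a. a \<in> A \<Longrightarrow> 0 \<le> p a" "\<And>b. b \<in> B \<Longrightarrow> 0 \<le> q b" "sum p A = 1" "sum q B = 1"
    and pairwise: "\<And>a b. a \<in> A \<Longrightarrow> b \<in> B \<Longrightarrow> tv_dist S (\<mu> a) (\<nu> b) \<le> \<delta>"
  shows "tv_dist S (\<lambda>y. \<Sum>a\<in>A. p a * \<mu> a y) (\<lambda>y. \<Sum>b\<in>B. q b * \<nu> b y) \<le> \<delta>"
proof -
  have "max 0 ((\<Sum>a\<in>A. p a * \<mu> a y) - (\<Sum>b\<in>B. q b * \<nu> b y))
      \<le> (\<Sum>a\<in>A. \<Sum>b\<in>B. p a * q b * max 0 (\<mu> a y - \<nu> b y))" for y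
  proof -
    have "(\<Sum>a\<in>A. p a * \<mu> a y) = (\<Sum>a\<in>A. \<Sum>b\<in>B. q b * (p a * \<mu> a y))"
      using assms(4) by (simp flip: sum_distrib_right)
    moreover have "(\<Sum>b\<in>B. q b * \<nu> b y) = (\<Sum>a\<in>A. \<Sum>b\<in>B. p a * (q b * \<nu> b y))"
      using assms(3) by (simp flip: sum_distrib_left sum_distrib_right)
    ultimately have "(\<Sum>a\<in>A. p a * \<mu> a y) - (\<Sum>b\<in>B. q b * \<nu> b y)
        = (\<Sum>a\<in>A. \<Sum>b\<in>B. p a * q b * (\<mu> a y - \<nu> b y))"
      by (simp only: sum_subtractf right_diff_distrib mult_ac)
    also have "\<dots> \<le> (\<Sum>a\<in>A. \<Sum>b\<in>B. p a * q b * max 0 (\<mu> a y - \<nu> b y))"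
      by (intro sum_mono mult_left_mono mult_nonneg_nonneg assms) auto
    finally show ?thesis
      by (auto intro!: sum_nonneg mult_nonneg_nonneg assms)
  qed
  then have "tv_dist S (\<lambda>y. \<Sum>a\<in>A. p a * \<mu> a y) (\<lambda>y. \<Sum>b\<in>B. q b * \<nu> b y)
      \<le> (\<Sum>y\<in>S. \<Sum>a\<in>A. \<Sum>b\<in>B. p a * q b * max 0 (\<mu> a y - \<nu> b y))"
    unfolding tv_dist_def by (intro sum_mono)
  also have "\<dots> = (\<Sum>a\<in>A. \<Sum>b\<in>B. p a * q b * tv_dist S (\<mu> a) (\<nu> b))"
    unfolding tv_dist_def sum_distrib_left
    by (subst sum.swap) (intro sum.cong refl sum.swap)
  also have "\<dots> \<le> (\<Sum>a\<in>A. \<Sum>b\<in>B. p a * q b * \<delta>)"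
    by (intro sum_mono mult_left_mono mult_nonneg_nonneg assms)
  also have "\<dots> = \<delta>"
    using assms(3,4) by (simp flip: sum_distrib_left sum_distrib_right)
  finally show ?thesis .
qed

lemma is_stationaryD:
  assumes "is_stationary S Q \<pi>"
  shows "x \<in> S \<Longrightarrow> 0 \<le> \<pi> x" and "x \<notin> S \<Longrightarrow> \<pi> x = 0" and "sum \<pi> S = 1"
    and "y \<in> S \<Longrightarrow> (\<Sum>x\<in>S. \<pi> x * Q x y) = 0"
  using assms by (auto simp: is_stationary_def)

lemma tv_dist_stationary_le:
  assumes "finite S" "x \<in> S" and \<pi>_stationary: "is_stationary S Q \<pi>" and mixed: "mixed_within S Q t \<delta>"
  shows "tv_dist S (expm S Q t x) \<pi> \<le> \<delta>"
proof -
  have "tv_dist S (expm S Q t x) \<pi>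
      = tv_dist S (\<lambda>y. \<Sum>a\<in>{x}. 1 * expm S Q t a y) (\<lambda>y. \<Sum>b\<in>S. \<pi> b * expm S Q t b y)"
    using stationary_expm[OF assms(1) _ is_stationaryD(4)[OF \<pi>_stationary]]
    by (intro tv_dist_cong) simp_all
  also have "\<dots> \<le> \<delta>"
    by (rule tv_dist_mixture_le)
       (use assms(2) mixed is_stationaryD[OF \<pi>_stationary] in \<open>auto simp: mixed_within_def\<close>)
  finally show ?thesis .
qed

lemma tv_dist_stationary_stationary_le:
  assumes "finite S" and \<pi>_stationary: "is_stationary S Q \<pi>" and \<rho>_stationary: "is_stationary S Q \<rho>"
    and mixed: "mixed_within S Q t \<delta>"
  shows "tv_dist S \<pi> \<rho> \<le> \<delta>"
proof -
  have "tv_dist S \<pi> \<rho>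
      = tv_dist S (\<lambda>y. \<Sum>a\<in>S. \<pi> a * expm S Q t a y) (\<lambda>y. \<Sum>b\<in>S. \<rho> b * expm S Q t b y)"
    using stationary_expm[OF assms(1) _ is_stationaryD(4)[OF \<pi>_stationary]]
      stationary_expm[OF assms(1) _ is_stationaryD(4)[OF \<rho>_stationary]]
        by (intro tv_dist_cong) simp_all
  also have "\<dots> \<le> \<delta>"
    by (rule tv_dist_mixture_le)
       (use mixed is_stationaryD[OF \<pi>_stationary] is_stationaryD[OF \<rho>_stationary]
        in \<open>auto simp: mixed_within_def\<close>)
  finally show ?thesis .
qed

lemma le_if_tv_dist_le_0:
  assumes "finite S" "x \<in> S" "tv_dist S \<mu> \<nu> \<le> 0"
  shows "\<mu> x \<le> \<nu> x"
proof -
  have "max 0 (\<mu> x - \<nu> x) \<le> tv_dist S \<mu> \<nu>"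
    unfolding tv_dist_def using assms(1,2) by (intro member_le_sum) auto
  with assms(3) show ?thesis by linarith
qed

lemma stationary_unique:
  assumes "finite S" and \<pi>_stationary: "is_stationary S Q \<pi>" and \<rho>_stationary: "is_stationary S Q \<rho>"
    and mixed: "\<And>k. mixed_within S Q (T k) (\<delta> k)" and "\<delta> \<longlonglongrightarrow> 0"
  shows "\<pi> = \<rho>"
proof
  fix x
  have tv_dist_le_0: "tv_dist S \<mu> \<nu> \<le> 0" if "is_stationary S Q \<mu>" "is_stationary S Q \<nu>" for \<mu> \<nu>
    using tv_dist_stationary_stationary_le[OF assms(1) that mixed]
    by (intro LIMSEQ_le_const[OF assms(5)]) auto
  show "\<pi> x = \<rho> x"
  proof (cases "x \<in> S")
    case True
    then show ?thesis
      using tv_dist_le_0[OF \<pi>_stationary \<rho>_stationary]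
        tv_dist_le_0[OF \<rho>_stationary \<pi>_stationary] le_if_tv_dist_le_0[OF assms(1)]
      by (meson antisym)
  qed (simp add: is_stationaryD(2)[OF \<pi>_stationary] is_stationaryD(2)[OF \<rho>_stationary])
qed

lemma tmix_le_if_tv_dist_equilibrium_le:
  assumes "0 \<le> t" "\<And>x. x \<in> S \<Longrightarrow> tv_dist S (expm S Q t x) (equilibrium S Q) \<le> \<epsilon>"
  shows "tmix S Q \<epsilon> \<le> t"
  unfolding tmix_def using assms by (intro cInf_lower) (auto intro: bdd_belowI[of _ 0])

theorem tmix_le_if_mixed_within:
  assumes "finite S" and \<pi>_stationary: "is_stationary S Q \<pi>"
    and "\<And>k. mixed_within S Q (T k) (\<delta> k)" "\<delta> \<longlonglongrightarrow> 0"
    and t_mixed: "0 \<le> t" "mixed_within S Q t \<epsilon>"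
  shows "tmix S Q \<epsilon> \<le> t"
proof (rule tmix_le_if_tv_dist_equilibrium_le[OF t_mixed(1)])
  fix x assume x_in_S: "x \<in> S"
  have "equilibrium S Q = \<pi>"
    unfolding equilibrium_def
    using \<pi>_stationary stationary_unique[OF assms(1) _ \<pi>_stationary assms(3,4)]
    by (rule the_equality)
  with tv_dist_stationary_le[OF assms(1) x_in_S \<pi>_stationary t_mixed(2)]
  show "tv_dist S (expm S Q t x) (equilibrium S Q) \<le> \<epsilon>" by simp
qed

lemma detailed_balance_stationary:
  assumes "finite S" "S \<noteq> {}" and weight_pos: "\<And>x. x \<in> S \<Longrightarrow> 0 < W x"
    and balance: "\<And>x y. x \<in> S \<Longrightarrow> y \<in> S \<Longrightarrow> W x * Q x y = W y * Q y x"
    and row_sum: "\<And>x. x \<in> S \<Longrightarrow> (\<Sum>y\<in>S. Q x y) = 0"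
  shows "is_stationary S Q (\<lambda>x. if x \<in> S then W x / sum W S else 0)"
proof -
  let ?\<pi> = "\<lambda>x. if x \<in> S then W x / sum W S else 0"
  have total_pos: "0 < sum W S" using assms(1,2) weight_pos by (intro sum_pos)
  have "(\<Sum>x\<in>S. ?\<pi> x * Q x y) = 0" if y_in_S: "y \<in> S" for y
  proof -
    have "(\<Sum>x\<in>S. ?\<pi> x * Q x y) = (\<Sum>x\<in>S. W y / sum W S * Q y x)"
      by (intro sum.cong refl) (simp add: balance y_in_S)
    also have "\<dots> = 0" by (simp only: row_sum y_in_S mult_zero_right flip: sum_distrib_left)
    finally show ?thesis .
  qed
  moreover have "(\<Sum>x\<in>S. ?\<pi> x) = 1"
    using total_pos by (simp flip: sum_divide_distrib)
  ultimately show ?thesis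
    using total_pos weight_pos by (auto simp: is_stationary_def less_imp_le)
qed

lemma tmix_singleton_le:
  assumes "Q x x = 0" "0 \<le> \<epsilon>"
  shows "tmix {x} Q \<epsilon> \<le> 0"
proof (rule tmix_le_if_mixed_within)
  show "is_stationary {x} Q (\<lambda>y. if y \<in> {x} then 1 / (\<Sum>y\<in>{x}. 1) else 0)"
    by (rule detailed_balance_stationary) (use assms in auto)
  show "mixed_within {x} Q 0 0" "mixed_within {x} Q 0 \<epsilon>"
    using assms(2) by (auto simp: mixed_within_def tv_dist_self)
qed auto

section \<open>Chains with killing\<close>

definition survival :: "'a set \<Rightarrow> ('a \<Rightarrow> 'a \<Rightarrow> real) \<Rightarrow> real \<Rightarrow> 'a \<Rightarrow> real" where
  "survival S Q t x = (\<Sum>y\<in>S. expm S Q t x y)"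

definition mean_lifetime :: "'a set \<Rightarrow> ('a \<Rightarrow> 'a \<Rightarrow> real) \<Rightarrow> 'a \<Rightarrow> ennreal" where
  "mean_lifetime S Q x = (\<integral>\<^sup>+ t. ennreal (survival S Q t x) * indicator {0..} t \<partial>lborel)"

lemma survival_eq_kernel_apply: "survival S Q t x = kernel_apply S (expm S Q t) (\<lambda>_. 1) x"
  by (simp add: survival_def kernel_apply_def)

definition poisson_weight :: "real \<Rightarrow> nat \<Rightarrow> real" where
  "poisson_weight t k = exp (- t) * (t ^ k / fact k)"

lemma poisson_weight_nonneg: "0 \<le> t \<Longrightarrow> 0 \<le> poisson_weight t k"
  by (simp add: poisson_weight_def)

lemma poisson_weight_sums: "poisson_weight t sums 1"
proof -
  have "(\<lambda>k. exp (-t) * (t ^ k /\<^sub>R fact k)) sums (exp (-t) * exp t)"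
    by (intro sums_mult exp_converges)
  then show ?thesis
    by (simp add: poisson_weight_def[abs_def] divide_inverse mult.commute flip: exp_add)
qed

locale uniformized =
  fixes S :: "'a set" and K Q :: "'a \<Rightarrow> 'a \<Rightarrow> real"
  assumes finite_states: "finite S"
    and kernel_nonneg: "\<And>x y. x \<in> S \<Longrightarrow> y \<in> S \<Longrightarrow> 0 \<le> K x y"
    and kernel_row_sum_le_1: "\<And>x. x \<in> S \<Longrightarrow> (\<Sum>y\<in>S. K x y) \<le> 1"
    and generator_eq: "\<And>x y. x \<in> S \<Longrightarrow> y \<in> S \<Longrightarrow> Q x y = K x y - (if x = y then 1 else 0)"
begin

lemma mpow_nonneg: "x \<in> S \<Longrightarrow> y \<in> S \<Longrightarrow> 0 \<le> mpow S K k x y"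
  by (induction k arbitrary: x) (auto intro!: sum_nonneg mult_nonneg_nonneg kernel_nonneg)

lemma mpow_row_sum_nonneg: "x \<in> S \<Longrightarrow> 0 \<le> kernel_apply S (mpow S K k) (\<lambda>_. 1) x"
  by (simp add: kernel_apply_def sum_nonneg mpow_nonneg)

lemma mpow_row_sum_le_1: "x \<in> S \<Longrightarrow> kernel_apply S (mpow S K k) (\<lambda>_. 1) x \<le> 1"
proof (induction k arbitrary: x)
  case 0
  then show ?case by (simp only: kernel_apply_mpow_0 finite_states)
next
  case (Suc k)
  have "kernel_apply S (mpow S K (Suc k)) (\<lambda>_. 1) x
      = (\<Sum>z\<in>S. K x z * kernel_apply S (mpow S K k) (\<lambda>_. 1) z)"
    unfolding kernel_apply_mpow_Suc by (simp only: kernel_apply_def)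
  also have "\<dots> \<le> (\<Sum>z\<in>S. K x z * 1)"
    using Suc by (intro sum_mono mult_left_mono kernel_nonneg)
  also have "\<dots> \<le> 1" using kernel_row_sum_le_1[OF Suc.prems] by simp
  finally show ?case .
qed

text \<open>The chain with generator \<open>K - 1\<close> makes Poisson many steps of \<open>K\<close>.\<close>

lemma expm_poisson_sums:
  assumes "x \<in> S" "y \<in> S"
  shows "(\<lambda>k. poisson_weight t k * mpow S K k x y) sums expm S Q t x y"
proof -
  have "expm S Q t x y = exp (- t) * expm S K t x y"
    using expm_add_scalar[OF finite_states assms, of Q K "-1" t] generator_eq by simp
  with sums_mult[OF expm_sums[OF finite_states assms(1)], of "exp (- t)" t K y]
  show ?thesis by (simp add: poisson_weight_def mult.assoc)
qed

lemma kernel_apply_expm_sums: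
  assumes "x \<in> S"
  shows "(\<lambda>k. poisson_weight t k * kernel_apply S (mpow S K k) f x)
           sums kernel_apply S (expm S Q t) f x"
  using sums_sum[of S "\<lambda>y k. poisson_weight t k * mpow S K k x y * f y", OF sums_mult2,
      OF expm_poisson_sums[OF assms]]
  by (simp add: kernel_apply_def sum_distrib_left mult.assoc)

lemma survival_sums:
  assumes "x \<in> S"
  shows "(\<lambda>k. poisson_weight t k * kernel_apply S (mpow S K k) (\<lambda>_. 1) x) sums survival S Q t x"
  unfolding survival_eq_kernel_apply by (rule kernel_apply_expm_sums[OF assms])

lemma expm_nonneg:
  assumes "x \<in> S" "y \<in> S" "0 \<le> t" shows "0 \<le> expm S Q t x y"
  by (rule sums_le[OF _ sums_zero expm_poisson_sums[OF assms(1,2)]])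
     (simp add: assms poisson_weight_nonneg mpow_nonneg)

lemma survival_le_1:
  assumes "x \<in> S" "0 \<le> t" shows "survival S Q t x \<le> 1"
  by (rule sums_le[OF _ survival_sums[OF assms(1)] poisson_weight_sums[of t]])
     (intro mult_left_le mpow_row_sum_le_1 poisson_weight_nonneg assms)

lemma survival_pos:
  assumes "x \<in> S" "0 \<le> t" shows "0 < survival S Q t x"
proof -
  let ?term = "\<lambda>k. poisson_weight t k * kernel_apply S (mpow S K k) (\<lambda>_. 1) x"
  have "exp (- t) = (\<Sum>k<Suc 0. ?term k)"
    using kernel_apply_mpow_0[OF finite_states assms(1), of K "\<lambda>_. 1"]
    by (simp del: mpow.simps add: poisson_weight_def)
  also have "\<dots> \<le> suminf ?term"
    by (intro sum_le_suminf sums_summable[OF survival_sums[OF assms(1)]] mult_nonneg_nonneg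
        poisson_weight_nonneg mpow_row_sum_nonneg assms) simp
  also have "\<dots> = survival S Q t x"
    by (rule sums_unique[OF survival_sums[OF assms(1)], symmetric])
  finally show ?thesis using exp_gt_zero[of "- t"] by linarith
qed

lemma survival_add_le:
  assumes "x \<in> S" "0 \<le> t" and survival_bound: "\<And>y. y \<in> S \<Longrightarrow> survival S Q u y \<le> c"
  shows "survival S Q (t + u) x \<le> survival S Q t x * c"
proof -
  have "survival S Q (t + u) x = (\<Sum>z\<in>S. \<Sum>y\<in>S. expm S Q t x y * expm S Q u y z)"
    by (simp add: survival_def expm_add[OF finite_states assms(1)] kernel_apply_def)
  also have "\<dots> = (\<Sum>y\<in>S. expm S Q t x y * survival S Q u y)"
    unfolding survival_def sum_distrib_left by (rule sum.swap)
  also have "\<dots> \<le> (\<Sum>y\<in>S. expm S Q t x y * c)"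
    by (intro sum_mono mult_left_mono survival_bound expm_nonneg assms)
  finally show ?thesis by (simp add: survival_def sum_distrib_right)
qed

lemma survival_antimono:
  assumes "x \<in> S" "0 \<le> t" "t \<le> u"
  shows "survival S Q u x \<le> survival S Q t x"
  using survival_add_le[OF assms(1,2), of "u - t" 1] survival_le_1[of _ "u - t"] assms(3) by simp

lemma survival_power_le:
  assumes "0 \<le> t" and survival_bound: "\<And>y. y \<in> S \<Longrightarrow> survival S Q t y \<le> c"
  shows "x \<in> S \<Longrightarrow> survival S Q (real k * t) x \<le> c ^ k"
proof (induction k)
  case 0
  then show ?case using survival_le_1[of x 0] by simp
next
  case (Suc k)
  have "survival S Q (real (Suc k) * t) x \<le> survival S Q (real k * t) x * c"
    using survival_add_le[OF Suc.prems, of "real k * t" t c] assms by (simp add: algebra_simps)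
  also have "\<dots> \<le> c ^ k * c"
    using Suc survival_pos[OF Suc.prems assms(1)] survival_bound[OF Suc.prems]
    by (intro mult_right_mono) auto
  finally show ?case by (simp add: mult.commute)
qed

lemma survival_Markov:
  assumes x_in_S: "x \<in> S" and t_nonneg: "0 \<le> t"
  shows "ennreal (survival S Q t x * t) \<le> mean_lifetime S Q x"
proof -
  have "ennreal (survival S Q t x * t)
      = (\<integral>\<^sup>+ u. ennreal (survival S Q t x) * indicator {0..t} u \<partial>lborel)"
    using survival_pos[OF x_in_S t_nonneg] t_nonneg
    by (simp add: ennreal_mult nn_integral_cmult_indicator)
  also have "\<dots> \<le> mean_lifetime S Q x"
    unfolding mean_lifetime_def
    by (intro nn_integral_mono)
       (auto simp: indicator_def intro!: ennreal_leI survival_antimono[OF x_in_S])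
  finally show ?thesis .
qed

lemma survival_exp_decay:
  assumes lifetime: "\<And>y. y \<in> S \<Longrightarrow> mean_lifetime S Q y \<le> ennreal M" and "0 \<le> M" and x_in_S: "x \<in> S"
  shows "survival S Q (real k * (exp 1 * M)) x \<le> exp (- 1) ^ k"
proof (rule survival_power_le[OF _ _ x_in_S])
  fix y assume y_in_S: "y \<in> S"
  have Markov: "survival S Q t y * t \<le> M" if "0 \<le> t" for t
    using order_trans[OF survival_Markov[OF y_in_S that] lifetime[OF y_in_S]] assms(2)
    by (simp add: ennreal_le_iff)
  have "0 < M" using Markov[of 1] survival_pos[OF y_in_S, of 1] by simp
  then show "survival S Q (exp 1 * M) y \<le> exp (- 1)"
    using Markov[of "exp 1 * M"] by (simp add: exp_minus divide_simps mult.commute)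
qed (use assms(2) in simp)

end

section \<open>Couplings with coalescence\<close>

text \<open>A triple in \<open>C\<close> pairs two states of the first chain with a state of the killed chain; the
  latter dies when the two states coalesce.\<close>

lemma mpow_coupling:
  assumes step: "\<And>g h x y p. (\<And>x y p. (x, y, p) \<in> C \<Longrightarrow> \<bar>g x - g y\<bar> \<le> h p) \<Longrightarrow> (x, y, p) \<in> C \<Longrightarrow>
      \<bar>kernel_apply S K g x - kernel_apply S K g y\<bar> \<le> kernel_apply T L h p"
    and states: "\<And>x y p. (x, y, p) \<in> C \<Longrightarrow> x \<in> S \<and> y \<in> S \<and> p \<in> T" "finite S" "finite T"
    and oscillation_le_1: "\<And>x y. \<bar>f x - f y\<bar> \<le> 1"
  shows "(x, y, p) \<in> C \<Longrightarrow>
    \<bar>kernel_apply S (mpow S K k) f x - kernel_apply S (mpow S K k) f y\<bar>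
      \<le> kernel_apply T (mpow T L k) (\<lambda>_. 1) p"
proof (induction k arbitrary: x y p)
  case 0
  then show ?case using states oscillation_le_1 by (simp only: kernel_apply_mpow_0 states(1)[OF 0])
next
  case (Suc k)
  show ?case unfolding kernel_apply_mpow_Suc by (rule step[OF Suc.IH Suc.prems])
qed

theorem tv_dist_le_survival:
  assumes "uniformized S K Q" "uniformized T L G"
    and step: "\<And>g h x y p. (\<And>x y p. (x, y, p) \<in> C \<Longrightarrow> \<bar>g x - g y\<bar> \<le> h p) \<Longrightarrow> (x, y, p) \<in> C \<Longrightarrow>
      \<bar>kernel_apply S K g x - kernel_apply S K g y\<bar> \<le> kernel_apply T L h p"
    and states: "\<And>x y p. (x, y, p) \<in> C \<Longrightarrow> x \<in> S \<and> y \<in> S \<and> p \<in> T"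
    and coupled: "(x, y, p) \<in> C" and t_nonneg: "0 \<le> t"
  shows "tv_dist S (expm S Q t x) (expm S Q t y) \<le> survival T G t p"
proof (rule tv_dist_le_if_test_functions_le)
  fix f :: "'a \<Rightarrow> real" assume test_function: "\<And>y. f y \<in> {0..1}"
  interpret chain: uniformized S K Q by (rule assms(1))
  interpret killed: uniformized T L G by (rule assms(2))
  have xyp_states: "x \<in> S" "y \<in> S" "p \<in> T" using states[OF coupled] by auto
  let ?D = "\<lambda>k. kernel_apply S (mpow S K k) f x - kernel_apply S (mpow S K k) f y"
  let ?A = "\<lambda>k. kernel_apply T (mpow T L k) (\<lambda>_. 1) p"
  let ?diff = "kernel_apply S (expm S Q t) f x - kernel_apply S (expm S Q t) f y"
  have "\<bar>f u - f v\<bar> \<le> 1" for u v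
    using test_function[of u] test_function[of v] by (simp add: abs_le_iff)
  then have "\<bar>?D k\<bar> \<le> ?A k" for k
    by (intro mpow_coupling[OF step states chain.finite_states killed.finite_states _ coupled])
  then have bound: "\<bar>poisson_weight t k * ?D k\<bar> \<le> poisson_weight t k * ?A k" for k
    using poisson_weight_nonneg[OF t_nonneg, of k] by (simp add: abs_mult mult_left_mono)
  have diff_sums: "(\<lambda>k. poisson_weight t k * ?D k) sums ?diff"
    unfolding right_diff_distrib by (intro sums_diff chain.kernel_apply_expm_sums xyp_states)
  have tail_sums: "(\<lambda>k. poisson_weight t k * ?A k) sums survival T G t p"
    by (rule killed.survival_sums[OF xyp_states(3)])
  have "?diff \<le> survival T G t p"
    by (rule sums_le[OF _ diff_sums tail_sums]) (use bound in \<open>simp add: abs_le_iff\<close>)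
  moreover have "- ?diff \<le> survival T G t p"
    by (rule sums_le[OF _ sums_minus[OF diff_sums] tail_sums]) (use bound in \<open>simp add: abs_le_iff\<close>)
  ultimately show "\<bar>(\<Sum>z\<in>S. expm S Q t x z * f z) - (\<Sum>z\<in>S. expm S Q t y z * f z)\<bar> \<le> survival T G t p"
    by (simp add: kernel_apply_def abs_le_iff)
qed

section \<open>Beta-binomial expectations\<close>

definition betabin_expect :: "real \<Rightarrow> nat \<Rightarrow> (nat \<Rightarrow> real) \<Rightarrow> real" where
  "betabin_expect s N \<phi> = (\<Sum>k\<le>N. betabin N s k * \<phi> k)"

text \<open>Conditionally on \<open>k\<close> of \<open>N\<close> particles having gone to the first endpoint, the next one goes
  there with this probability.\<close>

definition polya_prob :: "real \<Rightarrow> nat \<Rightarrow> nat \<Rightarrow> real" where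
  "polya_prob s N k = (real k + s) / (real N + 2 * s)"

lemma Beta_real_pos: "0 < a \<Longrightarrow> 0 < b \<Longrightarrow> 0 < Beta a (b::real)"
  by (simp add: Beta_def Gamma_real_pos)

lemma betabin_nonneg: "0 < s \<Longrightarrow> 0 \<le> betabin N s k"
  by (auto simp: betabin_def
      intro!: divide_nonneg_nonneg mult_nonneg_nonneg less_imp_le[OF Beta_real_pos])

lemma betabin_symmetric: "k \<le> N \<Longrightarrow> betabin N s (N - k) = betabin N s k"
  by (simp add: betabin_def Beta_commute binomial_symmetric[of k N])

lemma polya_prob_nonneg: "0 < s \<Longrightarrow> 0 \<le> polya_prob s N k"
  by (simp add: polya_prob_def)

lemma polya_prob_complement:
  "0 < s \<Longrightarrow> k \<le> N \<Longrightarrow> polya_prob s N k + polya_prob s N (N - k) = 1"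
  by (simp add: polya_prob_def of_nat_diff divide_simps)

lemma betabin_Suc_Suc:
  assumes "0 < s" "k \<le> N"
  shows "real (Suc k) * betabin (Suc N) s (Suc k) = real (Suc N) * (polya_prob s N k * betabin N s k)"
proof -
  let ?x = "real k + s" and ?y = "real (N - k) + s"
  have "?x + ?y = real N + 2 * s" using assms(2) by (simp add: of_nat_diff)
  moreover have "?x \<notin> \<int>\<^sub>\<le>\<^sub>0" using assms(1) by (auto simp: nonpos_Ints_def)
  ultimately have Beta_step: "Beta (?x + 1) ?y = polya_prob s N k * Beta ?x ?y"
    using Beta_plus1_left[of ?x ?y] assms(1) by (simp add: polya_prob_def field_simps)
  have binomial_step: "real (Suc k) * real (Suc N choose Suc k) = real (Suc N) * real (N choose k)"
    unfolding of_nat_mult[symmetric] Suc_times_binomial ..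
  have "betabin (Suc N) s (Suc k) = real (Suc N choose Suc k) * Beta (?x + 1) ?y / Beta s s"
    using assms(2) by (simp add: betabin_def add_ac del: binomial_Suc_Suc of_nat_diff)
  then have "real (Suc k) * betabin (Suc N) s (Suc k)
      = real (Suc k) * real (Suc N choose Suc k) * Beta (?x + 1) ?y / Beta s s"
    by (simp only: mult.assoc times_divide_eq_right)
  then show ?thesis
    unfolding binomial_step Beta_step using assms(2)
    by (simp add: betabin_def mult_ac del: of_nat_Suc of_nat_diff)
qed

lemma betabin_Suc:
  assumes "0 < s" "k \<le> N"
  shows "real (Suc N - k) * betabin (Suc N) s k
    = real (Suc N) * (polya_prob s N (N - k) * betabin N s k)"
  using betabin_Suc_Suc[OF assms(1), of "N - k" N] betabin_symmetric[of k "Suc N" s]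
    betabin_symmetric[OF assms(2)] assms(2) by (simp add: Suc_diff_le)

lemma betabin_expect_cong:
  assumes "\<And>k. k \<le> N \<Longrightarrow> \<phi> k = \<psi> k"
  shows "betabin_expect s N \<phi> = betabin_expect s N \<psi>"
  unfolding betabin_expect_def using assms by (intro sum.cong) auto

lemma betabin_expect_add:
  "betabin_expect s N (\<lambda>k. \<phi> k + \<psi> k) = betabin_expect s N \<phi> + betabin_expect s N \<psi>"
  by (simp add: betabin_expect_def distrib_left sum.distrib)

lemma betabin_expect_mult_right: "betabin_expect s N (\<lambda>k. \<phi> k * c) = betabin_expect s N \<phi> * c"
  by (simp add: betabin_expect_def sum_distrib_right mult.assoc)

lemma betabin_expect_reflect: "betabin_expect s N (\<lambda>k. \<phi> (N - k)) = betabin_expect s N \<phi>"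
  unfolding betabin_expect_def
  by (rule sum.reindex_bij_witness[of _ "\<lambda>k. N - k" "\<lambda>k. N - k"]) (auto simp: betabin_symmetric)

lemma abs_betabin_expect_diff_le:
  assumes "0 < s" "\<And>k. k \<le> N \<Longrightarrow> \<bar>\<phi> k - \<psi> k\<bar> \<le> \<omega> k"
  shows "\<bar>betabin_expect s N \<phi> - betabin_expect s N \<psi>\<bar> \<le> betabin_expect s N \<omega>"
  unfolding betabin_expect_def sum_subtractf[symmetric] right_diff_distrib[symmetric]
  by (rule order_trans[OF sum_abs sum_mono])
     (use assms in \<open>simp add: abs_mult betabin_nonneg mult_left_mono\<close>)

text \<open>Polya urn: the \<open>N + 1\<close>-st particle joins the first \<open>N\<close> ones.\<close>

lemma betabin_expect_Suc:
  assumes "0 < s"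
  shows "betabin_expect s (Suc N) \<phi>
    = betabin_expect s N (\<lambda>k. polya_prob s N k * \<phi> (Suc k) + polya_prob s N (N - k) * \<phi> k)"
proof -
  let ?b = "betabin (Suc N) s"
  have "real (Suc N) * betabin_expect s (Suc N) \<phi>
      = (\<Sum>k\<le>Suc N. real k * ?b k * \<phi> k + real (Suc N - k) * ?b k * \<phi> k)"
    unfolding betabin_expect_def sum_distrib_left
    by (intro sum.cong refl) (simp add: of_nat_diff algebra_simps)
  also have "\<dots> = (\<Sum>k\<le>Suc N. real k * ?b k * \<phi> k) + (\<Sum>k\<le>Suc N. real (Suc N - k) * ?b k * \<phi> k)"
    by (rule sum.distrib)
  also have "(\<Sum>k\<le>Suc N. real k * ?b k * \<phi> k) = (\<Sum>k\<le>N. real (Suc k) * ?b (Suc k) * \<phi> (Suc k))"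
    by (subst sum.atMost_Suc_shift) simp
  also have "\<dots> = (\<Sum>k\<le>N. real (Suc N) * (betabin N s k * (polya_prob s N k * \<phi> (Suc k))))"
    by (intro sum.cong refl) (simp add: betabin_Suc_Suc[OF assms] mult_ac del: of_nat_Suc)
  also have "(\<Sum>k\<le>Suc N. real (Suc N - k) * ?b k * \<phi> k) = (\<Sum>k\<le>N. real (Suc N - k) * ?b k * \<phi> k)"
    by simp
  also have "\<dots> = (\<Sum>k\<le>N. real (Suc N) * (betabin N s k * (polya_prob s N (N - k) * \<phi> k)))"
    by (intro sum.cong refl, subst betabin_Suc[OF assms]) (simp_all add: mult_ac del: of_nat_Suc)
  finally have "real (Suc N) * betabin_expect s (Suc N) \<phi> = real (Suc N) *
      betabin_expect s N (\<lambda>k. polya_prob s N k * \<phi> (Suc k) + polya_prob s N (N - k) * \<phi> k)"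
    by (simp only: betabin_expect_def distrib_left sum.distrib sum_distrib_left)
  then show ?thesis by (simp only: mult_cancel_left of_nat_eq_0_iff nat.simps simp_thms)
qed

lemma betabin_expect_const:
  assumes "0 < s"
  shows "betabin_expect s N (\<lambda>_. c) = c"
proof (induction N)
  case 0
  show ?case using Beta_real_pos[OF assms assms] by (simp add: betabin_expect_def betabin_def)
next
  case (Suc N)
  have "betabin_expect s (Suc N) (\<lambda>_. c) = betabin_expect s N (\<lambda>_. c)"
    unfolding betabin_expect_Suc[OF assms] distrib_right[symmetric]
    by (rule betabin_expect_cong) (simp add: polya_prob_complement[OF assms])
  with Suc show ?case by simp
qed

lemma betabin_expect_polya_prob:
  assumes "0 < s"
  shows "betabin_expect s N (polya_prob s N) = 1 / 2"
    and "betabin_expect s N (\<lambda>k. polya_prob s N (N - k)) = 1 / 2"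
proof -
  have "betabin_expect s N (polya_prob s N) + betabin_expect s N (\<lambda>k. polya_prob s N (N - k))
      = betabin_expect s N (\<lambda>_. 1)"
    unfolding betabin_expect_add[symmetric]
    by (rule betabin_expect_cong) (rule polya_prob_complement[OF assms])
  then show "betabin_expect s N (polya_prob s N) = 1 / 2"
    "betabin_expect s N (\<lambda>k. polya_prob s N (N - k)) = 1 / 2"
    by (simp_all add: betabin_expect_reflect betabin_expect_const[OF assms])
qed

lemma abs_betabin_expect_polya_diff_le:
  assumes s_pos: "0 < s"
    and first_close: "\<And>k. k \<le> N \<Longrightarrow> \<bar>\<phi> k - \<omega> k\<bar> \<le> a"
    and second_close: "\<And>k. k \<le> N \<Longrightarrow> \<bar>\<psi> k - \<omega> k\<bar> \<le> b"
  shows "\<bar>betabin_expect s N (\<lambda>k. polya_prob s N k * \<phi> k + polya_prob s N (N - k) * \<psi> k)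
      - betabin_expect s N \<omega>\<bar> \<le> (a + b) / 2"
proof -
  let ?p = "polya_prob s N"
  have "\<bar>?p k * \<phi> k + ?p (N - k) * \<psi> k - \<omega> k\<bar> \<le> ?p k * a + ?p (N - k) * b" if k_le_N: "k \<le> N" for k
  proof -
    have "\<omega> k = (?p k + ?p (N - k)) * \<omega> k" by (simp add: polya_prob_complement s_pos k_le_N)
    then have "?p k * \<phi> k + ?p (N - k) * \<psi> k - \<omega> k = ?p k * (\<phi> k - \<omega> k) + ?p (N - k) * (\<psi> k - \<omega> k)"
      by (simp only: algebra_simps)
    also have "\<bar>\<dots>\<bar> \<le> ?p k * \<bar>\<phi> k - \<omega> k\<bar> + ?p (N - k) * \<bar>\<psi> k - \<omega> k\<bar>"
      by (rule order_trans[OF abs_triangle_ineq]) (simp add: abs_mult polya_prob_nonneg s_pos)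
    also have "\<dots> \<le> ?p k * a + ?p (N - k) * b"
      by (intro add_mono mult_left_mono first_close second_close k_le_N polya_prob_nonneg s_pos)
    finally show ?thesis .
  qed
  then have "\<bar>betabin_expect s N (\<lambda>k. ?p k * \<phi> k + ?p (N - k) * \<psi> k) - betabin_expect s N \<omega>\<bar>
      \<le> betabin_expect s N (\<lambda>k. ?p k * a + ?p (N - k) * b)"
    by (rule abs_betabin_expect_diff_le[OF s_pos])
  also have "\<dots> = (a + b) / 2"
    by (simp add: betabin_expect_add betabin_expect_mult_right betabin_expect_polya_prob[OF s_pos])
  finally show ?thesis .
qed

section \<open>Particle configurations\<close>

definition add_particle :: "(nat \<Rightarrow> nat) \<Rightarrow> nat \<Rightarrow> nat \<Rightarrow> nat" where
  "add_particle \<zeta> i = \<zeta>(i := Suc (\<zeta> i))"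

definition split_at :: "nat \<Rightarrow> nat \<Rightarrow> (nat \<Rightarrow> nat) \<Rightarrow> nat \<Rightarrow> nat \<Rightarrow> nat" where
  "split_at v w \<zeta> k = \<zeta>(v := k, w := \<zeta> v + \<zeta> w - k)"

lemma add_particle_commute: "add_particle (add_particle \<zeta> i) j = add_particle (add_particle \<zeta> j) i"
  by (auto simp: add_particle_def fun_eq_iff)

lemma split_at_add_outside:
  "i \<noteq> v \<Longrightarrow> i \<noteq> w \<Longrightarrow> split_at v w (add_particle \<zeta> i) k = add_particle (split_at v w \<zeta> k) i"
  by (auto simp: split_at_def add_particle_def)

lemma split_at_add_first:
  "v \<noteq> w \<Longrightarrow> i \<in> {v, w} \<Longrightarrow>
    split_at v w (add_particle \<zeta> i) (Suc k) = add_particle (split_at v w \<zeta> k) v"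
  by (auto simp: split_at_def add_particle_def)

lemma split_at_add_second:
  "v \<noteq> w \<Longrightarrow> i \<in> {v, w} \<Longrightarrow> k \<le> \<zeta> v + \<zeta> w \<Longrightarrow>
    split_at v w (add_particle \<zeta> i) k = add_particle (split_at v w \<zeta> k) w"
  by (auto simp: split_at_def add_particle_def Suc_diff_le)

lemma inj_split_at: "v \<noteq> w \<Longrightarrow> inj (split_at v w \<zeta>)"
  by (rule injI) (metis fun_upd_apply split_at_def)

lemma split_at_image_eq:
  assumes "v \<noteq> w"
  shows "split_at v w \<xi> ` {..\<xi> v + \<xi> w}
    = {\<eta>. (\<forall>u. u \<notin> {v, w} \<longrightarrow> \<eta> u = \<xi> u) \<and> \<eta> v + \<eta> w = \<xi> v + \<xi> w}"
proof (intro equalityI subsetI)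
  fix \<eta> assume \<eta>_redistributes: "\<eta> \<in> {\<eta>. (\<forall>u. u \<notin> {v, w} \<longrightarrow> \<eta> u = \<xi> u) \<and> \<eta> v + \<eta> w = \<xi> v + \<xi> w}"
  then have "\<eta> = split_at v w \<xi> (\<eta> v)" by (auto simp: split_at_def fun_eq_iff)
  moreover have "\<eta> v \<le> \<xi> v + \<xi> w" using \<eta>_redistributes
    by (metis (mono_tags, lifting) le_add1 mem_Collect_eq)
  ultimately show "\<eta> \<in> split_at v w \<xi> ` {..\<xi> v + \<xi> w}" by blast
qed (use assms in \<open>auto simp: split_at_def\<close>)

lemma sum_add_particle:
  "finite A \<Longrightarrow> i \<in> A \<Longrightarrow> sum (add_particle \<zeta> i) A = Suc (sum \<zeta> A)"
  by (simp add: sum.remove[of A i] add_particle_def)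

lemma sum_split_at:
  assumes "finite A" "v \<in> A" "w \<in> A" "v \<noteq> w" "k \<le> \<zeta> v + \<zeta> w"
  shows "sum (split_at v w \<zeta> k) A = sum \<zeta> A"
proof -
  have "sum f A = f v + (f w + sum f (A - {v} - {w}))" for f :: "nat \<Rightarrow> nat"
    using assms by (simp add: sum.remove[of A v] sum.remove[of "A - {v}" w])
  moreover have "sum (split_at v w \<zeta> k) (A - {v} - {w}) = sum \<zeta> (A - {v} - {w})"
    by (intro sum.cong) (auto simp: split_at_def)
  ultimately show ?thesis using assms(4,5) by (simp add: split_at_def)
qed

lemma split_at_in_config_space:
  assumes "\<zeta> \<in> config_space n m" "v \<in> {1..n}" "w \<in> {1..n}" "v \<noteq> w" "k \<le> \<zeta> v + \<zeta> w"
  shows "split_at v w \<zeta> k \<in> config_space n m"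
proof -
  have "sum (split_at v w \<zeta> k) {1..n} = m"
    using assms sum_split_at[of "{1..n}" v w k \<zeta>] by (simp add: config_space_def)
  then show ?thesis using assms by (auto simp: config_space_def split_at_def)
qed

lemma add_particle_in_config_space:
  assumes "\<zeta> \<in> config_space n m" "i \<in> {1..n}"
  shows "add_particle \<zeta> i \<in> config_space n (Suc m)"
proof -
  have "sum (add_particle \<zeta> i) {1..n} = Suc m"
    using assms sum_add_particle[of "{1..n}" i \<zeta>] by (simp add: config_space_def)
  then show ?thesis using assms by (auto simp: config_space_def add_particle_def)
qed

lemma config_space_SucE:
  assumes "\<xi> \<in> config_space n (Suc m)"
  obtains \<zeta> i where "\<zeta> \<in> config_space n m" "i \<in> {1..n}" "\<xi> = add_particle \<zeta> i"
proof -
  have "sum \<xi> {1..n} \<noteq> 0" using assms by (simp add: config_space_def)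
  then obtain i where i_occupied: "i \<in> {1..n}" "\<xi> i \<noteq> 0" by (meson sum.neutral)
  define \<zeta> where "\<zeta> = \<xi>(i := \<xi> i - 1)"
  have \<xi>_eq: "\<xi> = add_particle \<zeta> i" using i_occupied by (auto simp: add_particle_def \<zeta>_def)
  have "Suc (sum \<zeta> {1..n}) = Suc m"
    using assms i_occupied(1) sum_add_particle[of "{1..n}" i \<zeta>] by (simp add: \<xi>_eq config_space_def)
  then have "\<zeta> \<in> config_space n m"
    using assms by (auto simp: config_space_def \<zeta>_def)
  with i_occupied \<xi>_eq that show ?thesis by blast
qed

lemma config_space_0: "config_space n 0 \<subseteq> {\<lambda>_. 0}"
  by (fastforce simp: config_space_def fun_eq_iff)

lemma finite_config_space: "finite (config_space n m)"
proof (induction m)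
  case 0
  show ?case using config_space_0 finite_subset by blast
next
  case (Suc m)
  have "config_space n (Suc m) \<subseteq> (\<lambda>(\<zeta>, i). add_particle \<zeta> i) ` (config_space n m \<times> {1..n})"
    by (force elim: config_space_SucE)
  then show ?case using Suc finite_subset by blast
qed

lemma config_space_nonempty:
  assumes "0 < n"
  shows "config_space n m \<noteq> {}"
proof -
  have "(\<lambda>u. if u = 1 then m else 0) \<in> config_space n m"
    using assms by (auto simp: config_space_def)
  then show ?thesis by blast
qed

lemma config_space_subsingleton:
  assumes "n < 2" "\<xi> \<in> config_space n m" "\<eta> \<in> config_space n m"
  shows "\<xi> = \<eta>"
proof
  fix u
  consider "n = 0" | "n = 1" using assms(1) by linarith
  then show "\<xi> u = \<eta> u"
    by cases (use assms in \<open>auto simp: config_space_def\<close>, metis)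
qed

definition adjacent :: "nat \<Rightarrow> nat \<Rightarrow> ((nat \<Rightarrow> nat) \<times> (nat \<Rightarrow> nat) \<times> nat \<times> nat) set" where
  "adjacent n m = {(add_particle \<zeta> i, add_particle \<zeta> j, i, j) | \<zeta> i j k.
     m = Suc k \<and> \<zeta> \<in> config_space n k \<and> (i, j) \<in> off_diag n}"

lemma adjacentI:
  "\<zeta> \<in> config_space n m \<Longrightarrow> i \<in> {1..n} \<Longrightarrow> j \<in> {1..n} \<Longrightarrow> i \<noteq> j \<Longrightarrow>
    (add_particle \<zeta> i, add_particle \<zeta> j, i, j) \<in> adjacent n (Suc m)"
  by (auto simp: adjacent_def off_diag_def)

lemma adjacentE:
  assumes "(\<xi>, \<eta>, p) \<in> adjacent n m"
  obtains \<zeta> i j k where "m = Suc k" "\<zeta> \<in> config_space n k" "i \<in> {1..n}" "j \<in> {1..n}" "i \<noteq> j"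
    "\<xi> = add_particle \<zeta> i" "\<eta> = add_particle \<zeta> j" "p = (i, j)"
  using assms by (auto simp: adjacent_def off_diag_def)

lemma adjacent_states:
  assumes "(\<xi>, \<eta>, p) \<in> adjacent n m"
  shows "\<xi> \<in> config_space n m \<and> \<eta> \<in> config_space n m \<and> p \<in> off_diag n"
  using assms by (auto elim!: adjacentE simp: add_particle_in_config_space off_diag_def)

lemma adjacent_add_particle:
  assumes "(\<xi>, \<eta>, p) \<in> adjacent n m" "a \<in> {1..n}"
  shows "(add_particle \<xi> a, add_particle \<eta> a, p) \<in> adjacent n (Suc m)"
  using assms(1)
proof (rule adjacentE)
  fix \<zeta> i j k assume "m = Suc k" "\<zeta> \<in> config_space n k" "i \<in> {1..n}" "j \<in> {1..n}" "i \<noteq> j"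
    "\<xi> = add_particle \<zeta> i" "\<eta> = add_particle \<zeta> j" "p = (i, j)"
  then show ?thesis
    using adjacentI[OF add_particle_in_config_space[OF _ assms(2)], of \<zeta> k i j]
    by (simp add: add_particle_commute[of \<zeta> a])
qed

lemma relpow_map:
  assumes "\<And>x y. (x, y) \<in> R \<Longrightarrow> (f x, f y) \<in> R'"
  shows "(x, y) \<in> R ^^ k \<Longrightarrow> (f x, f y) \<in> R' ^^ k"
proof (induction k arbitrary: y)
  case (Suc k)
  then show ?case using assms by (auto elim!: relpow_Suc_E intro: relpow_Suc_I)
qed simp

lemma relpow_bound:
  fixes d :: "'a \<Rightarrow> 'a \<Rightarrow> real"
  assumes "\<And>x. d x x \<le> 0" "\<And>x y z. d x z \<le> d x y + d y z"
    and "\<And>x y. (x, y) \<in> R \<Longrightarrow> d x y \<le> B"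
  shows "(x, y) \<in> R ^^ k \<Longrightarrow> d x y \<le> real k * B"
proof (induction k arbitrary: y)
  case 0
  then show ?case using assms(1)[of x] by simp
next
  case (Suc k)
  from Suc.prems obtain z where last_step: "(x, z) \<in> R ^^ k" "(z, y) \<in> R" by (rule relpow_Suc_E)
  have "d x y \<le> d x z + d z y" by (rule assms(2))
  also have "\<dots> \<le> real k * B + B"
    by (intro add_mono Suc.IH[OF last_step(1)] assms(3)[OF last_step(2)])
  finally show ?case by (simp add: algebra_simps)
qed

definition one_move :: "nat \<Rightarrow> nat \<Rightarrow> ((nat \<Rightarrow> nat) \<times> (nat \<Rightarrow> nat)) set" where
  "one_move n m = {(\<xi>, \<eta>). \<xi> = \<eta> \<or> (\<exists>p. (\<xi>, \<eta>, p) \<in> adjacent n m)}"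

lemma config_space_relpow_one_move:
  "\<xi> \<in> config_space n m \<Longrightarrow> \<eta> \<in> config_space n m \<Longrightarrow> (\<xi>, \<eta>) \<in> one_move n m ^^ m"
proof (induction m arbitrary: \<xi> \<eta>)
  case 0
  then show ?case using config_space_0 by auto
next
  case (Suc m)
  obtain \<zeta> i where \<xi>_decomp: "\<zeta> \<in> config_space n m" "i \<in> {1..n}" "\<xi> = add_particle \<zeta> i"
    by (rule config_space_SucE[OF Suc.prems(1)])
  obtain \<zeta>' j where \<eta>_decomp: "\<zeta>' \<in> config_space n m" "j \<in> {1..n}" "\<eta> = add_particle \<zeta>' j"
    by (rule config_space_SucE[OF Suc.prems(2)])
  have "(add_particle \<alpha> i, add_particle \<beta> i) \<in> one_move n (Suc m)" if "(\<alpha>, \<beta>) \<in> one_move n m" for \<alpha> \<beta>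
    using that adjacent_add_particle[OF _ \<xi>_decomp(2)] unfolding one_move_def by blast
  from relpow_map[OF this Suc.IH[OF \<xi>_decomp(1) \<eta>_decomp(1)]]
  have "(\<xi>, add_particle \<zeta>' i) \<in> one_move n (Suc m) ^^ m" by (simp only: \<xi>_decomp(3))
  moreover have "(add_particle \<zeta>' i, \<eta>) \<in> one_move n (Suc m)"
  proof (cases "i = j")
    case False
    then show ?thesis
      using adjacentI[OF \<eta>_decomp(1) \<xi>_decomp(2) \<eta>_decomp(2)] by (auto simp: one_move_def \<eta>_decomp(3))
  qed (simp add: one_move_def \<eta>_decomp(3))
  ultimately show ?case by (rule relpow_Suc_I)
qed

section \<open>Updates along an edge\<close>

definition split_expect :: "real \<Rightarrow> nat \<Rightarrow> nat \<Rightarrow> ((nat \<Rightarrow> nat) \<Rightarrow> real) \<Rightarrow> (nat \<Rightarrow> nat) \<Rightarrow> real" where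
  "split_expect s v w g \<xi> = betabin_expect s (\<xi> v + \<xi> w) (\<lambda>k. g (split_at v w \<xi> k))"

text \<open>The expectation of \<open>h\<close> after the edge \<open>e\<close> has rung, when a walker on \<open>e\<close> moves to a uniform
  endpoint and two walkers on \<open>e\<close> coalesce; \<open>h\<close> counts as zero after coalescence.\<close>

definition coalesce_expect :: "nat set \<Rightarrow> (nat \<times> nat \<Rightarrow> real) \<Rightarrow> nat \<times> nat \<Rightarrow> real" where
  "coalesce_expect e h = (\<lambda>(i, j). if i \<in> e then if j \<in> e then 0 else (\<Sum>z\<in>e. h (z, j)) / 2
     else if j \<in> e then (\<Sum>z\<in>e. h (i, z)) / 2 else h (i, j))"

lemma coalesce_expect_nonneg: "(\<And>q. 0 \<le> h q) \<Longrightarrow> 0 \<le> coalesce_expect e h p"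
  by (auto simp: coalesce_expect_def sum_nonneg split: prod.split)

lemma split_expect_const: "0 < s \<Longrightarrow> split_expect s v w (\<lambda>_. c) \<xi> = c"
  by (simp add: split_expect_def betabin_expect_const)

lemma split_expect_add_outside:
  assumes "i \<noteq> v" "i \<noteq> w"
  shows "split_expect s v w g (add_particle \<zeta> i)
    = betabin_expect s (\<zeta> v + \<zeta> w) (\<lambda>k. g (add_particle (split_at v w \<zeta> k) i))"
proof -
  have "add_particle \<zeta> i v + add_particle \<zeta> i w = \<zeta> v + \<zeta> w"
    using assms by (simp add: add_particle_def)
  then show ?thesis by (simp add: split_expect_def split_at_add_outside assms)
qed

lemma split_expect_add_inside:
  assumes "0 < s" "v \<noteq> w" "i \<in> {v, w}"
  defines "N \<equiv> \<lambda>\<zeta>. \<zeta> v + \<zeta> w"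
  shows "split_expect s v w g (add_particle \<zeta> i)
    = betabin_expect s (N \<zeta>) (\<lambda>k. polya_prob s (N \<zeta>) k * g (add_particle (split_at v w \<zeta> k) v)
        + polya_prob s (N \<zeta>) (N \<zeta> - k) * g (add_particle (split_at v w \<zeta> k) w))"
proof -
  have "add_particle \<zeta> i v + add_particle \<zeta> i w = Suc (N \<zeta>)"
    using assms(2,3) by (auto simp: add_particle_def N_def)
  then show ?thesis
    by (auto simp: split_expect_def betabin_expect_Suc assms(1) split_at_add_first[OF assms(2,3)]
        split_at_add_second[OF assms(2,3)] N_def intro!: betabin_expect_cong)
qed

lemma split_expect_half_contraction:
  assumes "0 < s" "v \<noteq> w" "i \<in> {v, w}" "j \<notin> {v, w}"
    and "\<And>k. k \<le> \<zeta> v + \<zeta> w \<Longrightarrow>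
      \<bar>g (add_particle (split_at v w \<zeta> k) v) - g (add_particle (split_at v w \<zeta> k) j)\<bar> \<le> a"
    and "\<And>k. k \<le> \<zeta> v + \<zeta> w \<Longrightarrow>
      \<bar>g (add_particle (split_at v w \<zeta> k) w) - g (add_particle (split_at v w \<zeta> k) j)\<bar> \<le> b"
  shows "\<bar>split_expect s v w g (add_particle \<zeta> i) - split_expect s v w g (add_particle \<zeta> j)\<bar>
    \<le> (a + b) / 2"
proof -
  have j_outside: "j \<noteq> v" "j \<noteq> w" using assms(4) by auto
  show ?thesis
    unfolding split_expect_add_inside[OF assms(1-3)] split_expect_add_outside[OF j_outside]
    by (intro abs_betabin_expect_polya_diff_le assms)
qed

lemma split_expect_add_contraction:
  assumes s_pos: "0 < s" and "v \<noteq> w" "i \<noteq> j"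
    and close: "\<And>a b k. a \<in> {v, w, i, j} \<Longrightarrow> b \<in> {v, w, i, j} \<Longrightarrow> a \<noteq> b \<Longrightarrow> k \<le> \<zeta> v + \<zeta> w \<Longrightarrow>
      \<bar>g (add_particle (split_at v w \<zeta> k) a) - g (add_particle (split_at v w \<zeta> k) b)\<bar> \<le> h (a, b)"
  shows "\<bar>split_expect s v w g (add_particle \<zeta> i) - split_expect s v w g (add_particle \<zeta> j)\<bar>
    \<le> coalesce_expect {v, w} h (i, j)"
proof -
  let ?E = "\<lambda>i. split_expect s v w g (add_particle \<zeta> i)"
  have close_commuted:
    "\<bar>g (add_particle (split_at v w \<zeta> k) b) - g (add_particle (split_at v w \<zeta> k) a)\<bar> \<le> h (a, b)"
    if "a \<in> {v, w, i, j}" "b \<in> {v, w, i, j}" "a \<noteq> b" "k \<le> \<zeta> v + \<zeta> w" for a b k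
    using close[OF that] by (simp only: abs_minus_commute)
  consider (both) "i \<in> {v, w}" "j \<in> {v, w}" | (first) "i \<in> {v, w}" "j \<notin> {v, w}"
    | (second) "i \<notin> {v, w}" "j \<in> {v, w}" | (neither) "i \<notin> {v, w}" "j \<notin> {v, w}" by blast
  then show ?thesis
  proof cases
    case both
    then have "?E i = ?E j" using split_expect_add_inside[OF s_pos assms(2)] by simp
    then show ?thesis using both by (simp add: coalesce_expect_def)
  next
    case first
    have "\<bar>?E i - ?E j\<bar> \<le> (h (v, j) + h (w, j)) / 2"
      by (rule split_expect_half_contraction) (use first assms(1,2) close in auto)
    then show ?thesis using first assms(2) by (auto simp: coalesce_expect_def)
  next
    case second
    have "\<bar>?E j - ?E i\<bar> \<le> (h (i, v) + h (i, w)) / 2"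
      by (rule split_expect_half_contraction) (use second assms(1,2) close_commuted in auto)
    then show ?thesis using second assms(2) by (auto simp: coalesce_expect_def abs_minus_commute)
  next
    case neither
    then have "\<bar>?E i - ?E j\<bar> \<le> betabin_expect s (\<zeta> v + \<zeta> w) (\<lambda>_. h (i, j))"
      using assms(3)
      by (auto simp: split_expect_add_outside intro!: abs_betabin_expect_diff_le s_pos close)
    then show ?thesis using neither by (simp add: betabin_expect_const s_pos coalesce_expect_def)
  qed
qed

lemma split_expect_contraction:
  assumes "0 < s" and edge: "v \<noteq> w" "{v, w} \<subseteq> {1..n}" and adjacent: "(\<xi>, \<eta>, p) \<in> adjacent n m"
    and contraction: "\<And>\<xi> \<eta> p. (\<xi>, \<eta>, p) \<in> adjacent n m \<Longrightarrow> \<bar>g \<xi> - g \<eta>\<bar> \<le> h p"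
  shows "\<bar>split_expect s v w g \<xi> - split_expect s v w g \<eta>\<bar> \<le> coalesce_expect {v, w} h p"
  using adjacent
proof (rule adjacentE)
  fix \<zeta> i j k
  assume \<zeta>_config: "m = Suc k" "\<zeta> \<in> config_space n k"
    and positions: "i \<in> {1..n}" "j \<in> {1..n}" "i \<noteq> j"
    and eqs: "\<xi> = add_particle \<zeta> i" "\<eta> = add_particle \<zeta> j" "p = (i, j)"
  have "(add_particle (split_at v w \<zeta> l) a, add_particle (split_at v w \<zeta> l) b, a, b) \<in> adjacent n m"
    if "a \<in> {v, w, i, j}" "b \<in> {v, w, i, j}" "a \<noteq> b" "l \<le> \<zeta> v + \<zeta> w" for a b l
    unfolding \<zeta>_config(1)
    by (rule adjacentI[OF split_at_in_config_space[OF \<zeta>_config(2)]]) (use that edge positions in auto)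
  then show ?thesis
    unfolding eqs by (intro split_expect_add_contraction assms(1) edge(1) positions(3) contraction)
qed

lemma split_kernel_eq:
  assumes "v < w"
  shows "split_kernel s {v, w} \<xi> \<eta>
    = (if \<eta> \<in> split_at v w \<xi> ` {..\<xi> v + \<xi> w} then betabin (\<xi> v + \<xi> w) s (\<eta> v) else 0)"
proof -
  have "Min {v, w} = v" "Max {v, w} = w" using assms by auto
  then show ?thesis
    unfolding split_kernel_def split_at_image_eq[OF less_imp_neq[OF assms]] Let_def by auto
qed

lemma kernel_apply_split_kernel:
  assumes "v < w" "v \<in> {1..n}" "w \<in> {1..n}" and \<xi>_config: "\<xi> \<in> config_space n m"
  shows "kernel_apply (config_space n m) (split_kernel s {v, w}) g \<xi> = split_expect s v w g \<xi>"
proof -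
  let ?N = "\<xi> v + \<xi> w"
  let ?T = "split_at v w \<xi> ` {..?N}"
  have image_subset: "?T \<subseteq> config_space n m"
    using split_at_in_config_space[OF \<xi>_config assms(2,3)] assms(1) by auto
  have "kernel_apply (config_space n m) (split_kernel s {v, w}) g \<xi>
      = (\<Sum>\<eta>\<in>?T. split_kernel s {v, w} \<xi> \<eta> * g \<eta>)"
    unfolding kernel_apply_def
    by (rule sum.mono_neutral_right[OF finite_config_space image_subset])
       (simp add: split_kernel_eq[OF assms(1)])
  also have "\<dots> = (\<Sum>\<eta>\<in>?T. betabin ?N s (\<eta> v) * g \<eta>)"
    by (intro sum.cong refl) (simp add: split_kernel_eq[OF assms(1)])
  also have "\<dots> = (\<Sum>k\<le>?N. betabin ?N s (split_at v w \<xi> k v) * g (split_at v w \<xi> k))"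
    by (rule sum.reindex[OF inj_on_subset[OF inj_split_at], unfolded o_def]) (use assms(1) in auto)
  also have "\<dots> = split_expect s v w g \<xi>"
    using assms(1) by (simp add: split_expect_def betabin_expect_def split_at_def)
  finally show ?thesis .
qed

definition particle_weight :: "real \<Rightarrow> nat \<Rightarrow> real" where
  "particle_weight s k = Gamma (real k + s) / fact k"

definition config_weight :: "nat \<Rightarrow> real \<Rightarrow> (nat \<Rightarrow> nat) \<Rightarrow> real" where
  "config_weight n s \<xi> = (\<Prod>v\<in>{1..n}. particle_weight s (\<xi> v))"

lemma config_weight_pos: "0 < s \<Longrightarrow> 0 < config_weight n s \<xi>"
  by (simp add: config_weight_def particle_weight_def prod_pos Gamma_real_pos)

lemma betabin_eq_particle_weight:
  assumes "k \<le> N"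
  shows "betabin N s k
    = fact N / (Gamma (real N + 2 * s) * Beta s s) * (particle_weight s k * particle_weight s (N - k))"
proof -
  have "real k + s + (real (N - k) + s) = real N + 2 * s" using assms by (simp add: of_nat_diff)
  then have "Beta (real k + s) (real (N - k) + s)
      = Gamma (real k + s) * Gamma (real (N - k) + s) / Gamma (real N + 2 * s)"
    by (simp only: Beta_def)
  then show ?thesis
    using assms
    by (simp add: betabin_def particle_weight_def binomial_fact mult_ac del: of_nat_diff)
qed

lemma split_kernel_reversible:
  assumes "v < w" "v \<in> {1..n}" "w \<in> {1..n}"
  shows "config_weight n s \<xi> * split_kernel s {v, w} \<xi> \<eta>
    = config_weight n s \<eta> * split_kernel s {v, w} \<eta> \<xi>"
proof (cases "(\<forall>u. u \<notin> {v, w} \<longrightarrow> \<eta> u = \<xi> u) \<and> \<eta> v + \<eta> w = \<xi> v + \<xi> w")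
  case True
  let ?p = "particle_weight s" and ?N = "\<xi> v + \<xi> w" and ?U = "{1..n} - {v} - {w}"
  let ?c = "fact ?N / (Gamma (real ?N + 2 * s) * Beta s s)"
  have weight: "config_weight n s \<theta> = ?p (\<theta> v) * (?p (\<theta> w) * (\<Prod>u\<in>?U. ?p (\<theta> u)))" for \<theta>
    unfolding config_weight_def using assms by (simp add: prod.remove[of _ v] prod.remove[of _ w])
  have kernel: "split_kernel s {v, w} \<theta> \<theta>' = ?c * (?p (\<theta>' v) * ?p (\<theta>' w))"
    if "\<theta>' \<in> split_at v w \<theta> ` {..\<theta> v + \<theta> w}" "\<theta> v + \<theta> w = ?N" "\<theta>' v + \<theta>' w = ?N" for \<theta> \<theta>'
  proof -
    have "?N - \<theta>' v = \<theta>' w" "\<theta>' v \<le> ?N" using that(3) by auto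
    then show ?thesis
      unfolding split_kernel_eq[OF assms(1)] using that betabin_eq_particle_weight[of "\<theta>' v" ?N s]
      by simp
  qed
  have "\<eta> \<in> split_at v w \<xi> ` {..\<xi> v + \<xi> w}" "\<xi> \<in> split_at v w \<eta> ` {..\<eta> v + \<eta> w}"
    using True unfolding split_at_image_eq[OF less_imp_neq[OF assms(1)]] by auto
  then have "split_kernel s {v, w} \<xi> \<eta> = ?c * (?p (\<eta> v) * ?p (\<eta> w))"
    "split_kernel s {v, w} \<eta> \<xi> = ?c * (?p (\<xi> v) * ?p (\<xi> w))"
    using True by (blast intro: kernel)+
  moreover have "(\<Prod>u\<in>?U. ?p (\<xi> u)) = (\<Prod>u\<in>?U. ?p (\<eta> u))"
    using True by (intro prod.cong) auto
  ultimately show ?thesis unfolding weight by (simp add: mult_ac)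
next
  case False
  then have "split_kernel s {v, w} \<xi> \<eta> = 0" "split_kernel s {v, w} \<eta> \<xi> = 0"
    using assms(1) by (auto simp: split_kernel_eq split_at_image_eq)
  then show ?thesis by simp
qed

section \<open>The two chains on a weighted graph\<close>

lemma walk_gen_apply:
  assumes "i \<in> {1..n}"
  shows "kernel_apply {1..n} (walk_gen n E r) \<phi> i
    = (\<Sum>x | x \<in> {1..n} - {i} \<and> {i, x} \<in> E. r {i, x} / (2 * total_weight E r) * (\<phi> x - \<phi> i))"
proof -
  let ?W = "\<lambda>x. if {i, x} \<in> E then r {i, x} / (2 * total_weight E r) else 0"
  have "kernel_apply {1..n} (walk_gen n E r) \<phi> i
      = walk_gen n E r i i * \<phi> i + (\<Sum>x\<in>{1..n} - {i}. walk_gen n E r i x * \<phi> x)"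
    unfolding kernel_apply_def using assms by (subst sum.remove[of _ i]) auto
  also have "(\<Sum>x\<in>{1..n} - {i}. walk_gen n E r i x * \<phi> x) = (\<Sum>x\<in>{1..n} - {i}. ?W x * \<phi> x)"
    by (intro sum.cong refl) (auto simp: walk_gen_def)
  also have "walk_gen n E r i i * \<phi> i = - (\<Sum>x\<in>{1..n} - {i}. ?W x * \<phi> i)"
    by (simp add: walk_gen_def sum_distrib_right)
  also have "- (\<Sum>x\<in>{1..n} - {i}. ?W x * \<phi> i) + (\<Sum>x\<in>{1..n} - {i}. ?W x * \<phi> x)
      = (\<Sum>x\<in>{1..n} - {i}. if {i, x} \<in> E then r {i, x} / (2 * total_weight E r) * (\<phi> x - \<phi> i) else 0)"
    unfolding uminus_add_conv_diff sum_subtractf[symmetric]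
    by (intro sum.cong refl) (simp add: right_diff_distrib)
  also have "\<dots> = (\<Sum>x | x \<in> {1..n} - {i} \<and> {i, x} \<in> E. r {i, x} / (2 * total_weight E r) * (\<phi> x - \<phi> i))"
    by (rule sum.inter_filter[symmetric]) simp
  finally show ?thesis .
qed

lemma finite_off_diag: "finite (off_diag n)"
  by (rule finite_subset[of _ "{1..n} \<times> {1..n}"]) (auto simp: off_diag_def)

lemma pair_gen_apply:
  assumes "(i, j) \<in> off_diag n"
  shows "kernel_apply (off_diag n) (pair_gen n E r) h (i, j)
    = kernel_apply {1..n} (walk_gen n E r) (\<lambda>x. if x = j then 0 else h (x, j)) i
    + kernel_apply {1..n} (walk_gen n E r) (\<lambda>y. if y = i then 0 else h (i, y)) j"
proof -
  let ?V = "{1..n}" and ?w = "walk_gen n E r"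
  let ?h = "\<lambda>x y. if x = y then 0 else h (x, y)"
  have "kernel_apply (off_diag n) (pair_gen n E r) h (i, j)
      = (\<Sum>(x, y)\<in>?V \<times> ?V. pair_gen n E r (i, j) (x, y) * ?h x y)"
    unfolding kernel_apply_def by (rule sum.mono_neutral_cong_left) (auto simp: off_diag_def)
  also have "\<dots> = (\<Sum>x\<in>?V. \<Sum>y\<in>?V. pair_gen n E r (i, j) (x, y) * ?h x y)"
    by (rule sum.cartesian_product[symmetric])
  also have "\<dots> = (\<Sum>x\<in>?V. \<Sum>y\<in>?V. (if j = y then ?w i x * ?h x y else 0)
      + (if i = x then ?w j y * ?h x y else 0))"
    by (intro sum.cong refl) (simp add: pair_gen_def distrib_right)
  also have "\<dots> = (\<Sum>x\<in>?V. \<Sum>y\<in>?V. if j = y then ?w i x * ?h x y else 0)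
      + (\<Sum>y\<in>?V. \<Sum>x\<in>?V. if i = x then ?w j y * ?h x y else 0)"
    unfolding sum.distrib by (subst (3) sum.swap) (rule refl)
  also have "\<dots> = (\<Sum>x\<in>?V. ?w i x * ?h x j) + (\<Sum>y\<in>?V. ?w j y * ?h i y)"
    using assms by (simp add: off_diag_def)
  also have "(\<Sum>y\<in>?V. ?w j y * ?h i y) = (\<Sum>y\<in>?V. ?w j y * (if y = i then 0 else h (i, y)))"
    by (intro sum.cong refl) simp
  finally show ?thesis by (simp only: kernel_apply_def)
qed

lemma meet_tail_eq_survival: "meet_tail n E r i j t = survival (off_diag n) (pair_gen n E r) t (i, j)"
  by (simp add: meet_tail_def survival_def)

lemma mean_lifetime_le_max_exp_meet:
  assumes "p \<in> off_diag n"
  shows "mean_lifetime (off_diag n) (pair_gen n E r) p \<le> max_exp_meet n E r"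
  unfolding max_exp_meet_def
  using SUP_upper[OF assms, of "\<lambda>p. exp_meet n E r (fst p) (snd p)"]
  by (simp add: exp_meet_def mean_lifetime_def meet_tail_eq_survival)

locale bb_graph =
  fixes n :: nat and E :: "nat set set" and r :: "nat set \<Rightarrow> real" and s :: real
  assumes graph: "weighted_conn_graph n E r" and n_ge_2: "2 \<le> n" and s_pos: "0 < s"
begin

definition edge_average :: "(nat set \<Rightarrow> real) \<Rightarrow> real" where
  "edge_average \<phi> = (\<Sum>e\<in>E. r e / total_weight E r * \<phi> e)"

definition bb_kernel :: "(nat \<Rightarrow> nat) \<Rightarrow> (nat \<Rightarrow> nat) \<Rightarrow> real" where
  "bb_kernel \<xi> \<eta> = edge_average (\<lambda>e. split_kernel s e \<xi> \<eta>)"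

definition pair_kernel :: "nat \<times> nat \<Rightarrow> nat \<times> nat \<Rightarrow> real" where
  "pair_kernel p q = pair_gen n E r p q + (if p = q then 1 else 0)"

lemma finite_edges: "finite E"
  using graph finite_subset[of E "Pow {1..n}"] by (auto simp: weighted_conn_graph_def)

lemma edgeE:
  assumes "e \<in> E"
  obtains v w where "e = {v, w}" "v < w" "v \<in> {1..n}" "w \<in> {1..n}" "Min e = v" "Max e = w"
proof -
  have "e \<subseteq> {1..n}" "card e = 2" using graph assms by (auto simp: weighted_conn_graph_def)
  then obtain x y where ends: "e = {x, y}" "x \<noteq> y" by (meson card_2_iff)
  define v w where "v = min x y" and "w = max x y"
  have "e = {v, w}" "v < w" using ends by (auto simp: v_def w_def min_def max_def)
  with \<open>e \<subseteq> {1..n}\<close> that show ?thesis by auto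
qed

lemma edge_weight_pos: "e \<in> E \<Longrightarrow> 0 < r e"
  using graph by (auto simp: weighted_conn_graph_def)

lemma edges_nonempty: "E \<noteq> {}"
proof
  assume "E = {}"
  moreover have "(1, 2) \<in> {(x, y). {x, y} \<in> E}\<^sup>*"
    using graph n_ge_2 by (auto simp: weighted_conn_graph_def)
  ultimately show False by (auto elim: rtranclE)
qed

lemma total_weight_pos: "0 < total_weight E r"
  unfolding total_weight_def by (intro sum_pos finite_edges edges_nonempty edge_weight_pos)

lemma rate_nonneg: "e \<in> E \<Longrightarrow> 0 \<le> r e / total_weight E r"
  using edge_weight_pos total_weight_pos by (simp add: less_imp_le)

lemma edge_average_const: "edge_average (\<lambda>_. c) = c"
  using total_weight_pos
  by (simp add: edge_average_def total_weight_def flip: sum_distrib_right sum_divide_distrib)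

lemma edge_average_mono:
  "(\<And>e. e \<in> E \<Longrightarrow> \<phi> e \<le> \<psi> e) \<Longrightarrow> edge_average \<phi> \<le> edge_average \<psi>"
  unfolding edge_average_def by (intro sum_mono mult_left_mono rate_nonneg)

lemma edge_average_diff: "edge_average \<phi> - edge_average \<psi> = edge_average (\<lambda>e. \<phi> e - \<psi> e)"
  by (simp add: edge_average_def right_diff_distrib sum_subtractf)

lemma edge_average_nonneg: "(\<And>e. e \<in> E \<Longrightarrow> 0 \<le> \<phi> e) \<Longrightarrow> 0 \<le> edge_average \<phi>"
  using edge_average_mono[of "\<lambda>_. 0" \<phi>] by (simp add: edge_average_const)

lemma abs_edge_average_diff_le:
  assumes "\<And>e. e \<in> E \<Longrightarrow> \<bar>\<phi> e - \<psi> e\<bar> \<le> \<omega> e"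
  shows "\<bar>edge_average \<phi> - edge_average \<psi>\<bar> \<le> edge_average \<omega>"
  unfolding edge_average_diff unfolding edge_average_def
  by (rule order_trans[OF sum_abs sum_mono])
     (simp add: abs_mult assms edge_weight_pos total_weight_pos less_imp_le divide_right_mono
        mult_left_mono)

lemma kernel_apply_bb_kernel:
  assumes "\<xi> \<in> config_space n m"
  shows "kernel_apply (config_space n m) bb_kernel g \<xi>
    = edge_average (\<lambda>e. split_expect s (Min e) (Max e) g \<xi>)"
proof -
  have "kernel_apply (config_space n m) bb_kernel g \<xi>
      = edge_average (\<lambda>e. kernel_apply (config_space n m) (split_kernel s e) g \<xi>)"
    unfolding bb_kernel_def kernel_apply_def edge_average_def
      sum_distrib_left sum_distrib_right mult.assoc
    by (rule sum.swap)
  also have "\<dots> = edge_average (\<lambda>e. split_expect s (Min e) (Max e) g \<xi>)"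
    unfolding edge_average_def
    by (intro sum.cong refl) (auto elim!: edgeE simp: kernel_apply_split_kernel[OF _ _ _ assms])
  finally show ?thesis .
qed

lemma bb_kernel_row_sum:
  assumes "\<xi> \<in> config_space n m"
  shows "(\<Sum>\<eta>\<in>config_space n m. bb_kernel \<xi> \<eta>) = 1"
  using kernel_apply_bb_kernel[OF assms, of "\<lambda>_. 1"]
  by (simp add: split_expect_const s_pos edge_average_const) (simp add: kernel_apply_def)

lemma BB_gen_eq: "BB_gen E r s \<xi> \<eta> = bb_kernel \<xi> \<eta> - (if \<xi> = \<eta> then 1 else 0)"
proof -
  have "BB_gen E r s \<xi> \<eta> = edge_average (\<lambda>e. split_kernel s e \<xi> \<eta> - (if \<xi> = \<eta> then 1 else 0))"
    by (simp only: BB_gen_def edge_average_def)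
  then show ?thesis
    by (simp only: bb_kernel_def edge_average_const flip: edge_average_diff)
qed

lemma uniformized_bb: "uniformized (config_space n m) bb_kernel (BB_gen E r s)"
proof
  show "0 \<le> bb_kernel \<xi> \<eta>" for \<xi> \<eta>
    unfolding bb_kernel_def
    by (rule edge_average_nonneg) (simp add: split_kernel_def Let_def betabin_nonneg s_pos)
qed (simp_all add: finite_config_space bb_kernel_row_sum BB_gen_eq)

lemma walk_gen_apply_edges:
  assumes "i \<in> {1..n}"
  shows "kernel_apply {1..n} (walk_gen n E r) \<phi> i
    = edge_average (\<lambda>e. if i \<in> e then (\<Sum>z\<in>e. \<phi> z) / 2 - \<phi> i else 0)"
proof -
  let ?R = "total_weight E r"
  let ?A = "{x \<in> {1..n} - {i}. {i, x} \<in> E}"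
  have inj: "inj_on (\<lambda>x. {i, x}) ?A" by (auto simp: inj_on_def doubleton_eq_iff)
  have image: "(\<lambda>x. {i, x}) ` ?A = {e \<in> E. i \<in> e}"
  proof (intro equalityI subsetI)
    fix e assume e_at_i: "e \<in> {e \<in> E. i \<in> e}"
    then obtain v w where "e = {v, w}" "v < w" "v \<in> {1..n}" "w \<in> {1..n}" by (auto elim: edgeE)
    then have "e = {i, v + w - i}" "v + w - i \<in> {1..n} - {i}" using e_at_i by auto
    with e_at_i show "e \<in> (\<lambda>x. {i, x}) ` ?A" by (intro image_eqI[of _ _ "v + w - i"]) auto
  qed auto
  have "kernel_apply {1..n} (walk_gen n E r) \<phi> i
      = (\<Sum>x\<in>?A. r {i, x} / ?R * ((\<Sum>z\<in>{i, x}. \<phi> z) / 2 - \<phi> i))"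
    unfolding walk_gen_apply[OF assms] by (intro sum.cong refl) (auto simp: field_simps)
  also have "\<dots> = (\<Sum>e | e \<in> E \<and> i \<in> e. r e / ?R * ((\<Sum>z\<in>e. \<phi> z) / 2 - \<phi> i))"
    unfolding image[symmetric] by (subst sum.reindex[OF inj]) (simp only: o_def)
  also have "\<dots> = (\<Sum>e\<in>E. if i \<in> e then r e / ?R * ((\<Sum>z\<in>e. \<phi> z) / 2 - \<phi> i) else 0)"
    by (rule sum.inter_filter[OF finite_edges])
  also have "\<dots> = edge_average (\<lambda>e. if i \<in> e then (\<Sum>z\<in>e. \<phi> z) / 2 - \<phi> i else 0)"
    unfolding edge_average_def by (intro sum.cong refl) simp
  finally show ?thesis .
qed

text \<open>Two walkers at the ends of an edge meet across it at twice the rate at which each of them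
  jumps, which is the rate at which the edge rings.\<close>

lemma pair_gen_apply_edges:
  assumes p_off_diag: "p \<in> off_diag n"
  shows "kernel_apply (off_diag n) (pair_gen n E r) h p = edge_average (\<lambda>e. coalesce_expect e h p - h p)"
proof -
  obtain i j where p_eq: "p = (i, j)" "i \<in> {1..n}" "j \<in> {1..n}" "i \<noteq> j"
    using p_off_diag by (auto simp: off_diag_def)
  let ?f = "\<lambda>x. if x = j then 0 else h (x, j)" and ?g = "\<lambda>y. if y = i then 0 else h (i, y)"
  have "kernel_apply (off_diag n) (pair_gen n E r) h p
      = edge_average (\<lambda>e. if i \<in> e then (\<Sum>z\<in>e. ?f z) / 2 - ?f i else 0)
      + edge_average (\<lambda>e. if j \<in> e then (\<Sum>z\<in>e. ?g z) / 2 - ?g j else 0)"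
    using pair_gen_apply p_off_diag unfolding p_eq(1) by (simp only: walk_gen_apply_edges p_eq(2,3))
  also have "\<dots> = edge_average (\<lambda>e. coalesce_expect e h p - h p)"
    unfolding edge_average_def sum.distrib[symmetric] distrib_left[symmetric]
  proof (intro sum.cong refl arg_cong[where f = "(*) _"])
    fix e assume "e \<in> E"
    then obtain v w where e_eq: "e = {v, w}" "v < w" by (rule edgeE)
    show "(if i \<in> e then (\<Sum>z\<in>e. ?f z) / 2 - ?f i else 0)
        + (if j \<in> e then (\<Sum>z\<in>e. ?g z) / 2 - ?g j else 0) = coalesce_expect e h p - h p"
      using e_eq(2) p_eq(4) by (auto simp: e_eq(1) coalesce_expect_def p_eq(1))
  qed
  finally show ?thesis .
qed

lemma kernel_apply_pair_kernel:
  assumes p_off_diag: "p \<in> off_diag n"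
  shows "kernel_apply (off_diag n) pair_kernel h p = edge_average (\<lambda>e. coalesce_expect e h p)"
proof -
  have "kernel_apply (off_diag n) pair_kernel h p
      = kernel_apply (off_diag n) (pair_gen n E r) h p + h p"
    using kernel_apply_identity[OF finite_off_diag p_off_diag, of h]
    by (simp add: kernel_apply_def pair_kernel_def distrib_right sum.distrib)
  also have "\<dots> = edge_average (\<lambda>e. coalesce_expect e h p)"
    unfolding pair_gen_apply_edges[OF p_off_diag] edge_average_diff[symmetric] edge_average_const
    by simp
  finally show ?thesis .
qed

lemma coalesce_expect_one_le_1: "e \<in> E \<Longrightarrow> coalesce_expect e (\<lambda>_. 1) p \<le> 1"
  by (auto simp: coalesce_expect_def elim!: edgeE split: prod.split)

lemma uniformized_pair: "uniformized (off_diag n) pair_kernel (pair_gen n E r)"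
proof
  show "finite (off_diag n)" by (rule finite_off_diag)
  show "0 \<le> pair_kernel p q" if "p \<in> off_diag n" "q \<in> off_diag n" for p q
  proof -
    have "pair_kernel p q = edge_average (\<lambda>e. coalesce_expect e (\<lambda>z. if z = q then 1 else 0) p)"
      unfolding kernel_apply_pair_kernel[OF that(1), symmetric]
      by (rule kernel_apply_indicator[OF finite_off_diag that(2), symmetric])
    also have "\<dots> \<ge> 0" by (intro edge_average_nonneg coalesce_expect_nonneg) simp
    finally show ?thesis .
  qed
  show "(\<Sum>q\<in>off_diag n. pair_kernel p q) \<le> 1" if "p \<in> off_diag n" for p
  proof -
    have "(\<Sum>q\<in>off_diag n. pair_kernel p q) = edge_average (\<lambda>e. coalesce_expect e (\<lambda>_. 1) p)"
      using kernel_apply_pair_kernel[OF that, of "\<lambda>_. 1"] by (simp add: kernel_apply_def)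
    also have "\<dots> \<le> edge_average (\<lambda>_. 1)" by (intro edge_average_mono coalesce_expect_one_le_1)
    finally show ?thesis by (simp only: edge_average_const)
  qed
  show "pair_gen n E r p q = pair_kernel p q - (if p = q then 1 else 0)" for p q
    by (simp add: pair_kernel_def)
qed

lemma bb_kernel_contraction:
  assumes contraction: "\<And>\<xi> \<eta> p. (\<xi>, \<eta>, p) \<in> adjacent n m \<Longrightarrow> \<bar>g \<xi> - g \<eta>\<bar> \<le> h p"
    and adjacent: "(\<xi>, \<eta>, p) \<in> adjacent n m"
  shows "\<bar>kernel_apply (config_space n m) bb_kernel g \<xi> - kernel_apply (config_space n m) bb_kernel g \<eta>\<bar>
    \<le> kernel_apply (off_diag n) pair_kernel h p"
proof -
  have states: "\<xi> \<in> config_space n m" "\<eta> \<in> config_space n m" "p \<in> off_diag n"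
    using adjacent_states[OF adjacent] by auto
  have "\<bar>split_expect s (Min e) (Max e) g \<xi> - split_expect s (Min e) (Max e) g \<eta>\<bar>
      \<le> coalesce_expect e h p"
    if "e \<in> E" for e
  proof -
    obtain v w where "e = {v, w}" "v < w" "v \<in> {1..n}" "w \<in> {1..n}" "Min e = v" "Max e = w"
      by (rule edgeE[OF \<open>e \<in> E\<close>])
    then show ?thesis using split_expect_contraction[OF s_pos _ _ adjacent contraction, of v w] by simp
  qed
  then show ?thesis
    unfolding kernel_apply_bb_kernel[OF states(1)] kernel_apply_bb_kernel[OF states(2)]
      kernel_apply_pair_kernel[OF states(3)] by (rule abs_edge_average_diff_le)
qed

lemma stationary_exists: "\<exists>\<pi>. is_stationary (config_space n m) (BB_gen E r s) \<pi>"
proof (rule exI, rule detailed_balance_stationary[where W = "config_weight n s"])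
  show "config_space n m \<noteq> {}" using n_ge_2 by (intro config_space_nonempty) simp
  show "(\<Sum>\<eta>\<in>config_space n m. BB_gen E r s \<xi> \<eta>) = 0" if "\<xi> \<in> config_space n m" for \<xi>
    using that by (simp add: BB_gen_eq sum_subtractf bb_kernel_row_sum finite_config_space)
  show "config_weight n s \<xi> * BB_gen E r s \<xi> \<eta> = config_weight n s \<eta> * BB_gen E r s \<eta> \<xi>" for \<xi> \<eta>
  proof -
    have "config_weight n s \<xi> * split_kernel s e \<xi> \<eta> = config_weight n s \<eta> * split_kernel s e \<eta> \<xi>"
      if "e \<in> E" for e
      using that by (rule edgeE) (simp add: split_kernel_reversible)
    then have "config_weight n s \<xi> * bb_kernel \<xi> \<eta> = config_weight n s \<eta> * bb_kernel \<eta> \<xi>"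
      unfolding bb_kernel_def edge_average_def sum_distrib_left
        mult.left_commute[of "config_weight n s _"]
      by (intro sum.cong refl) simp
    then show ?thesis by (auto simp: BB_gen_eq right_diff_distrib)
  qed
qed (simp_all add: finite_config_space config_weight_pos s_pos)

lemma mixed_within_if_survival_le:
  assumes "0 \<le> t" and tail: "\<And>p. p \<in> off_diag n \<Longrightarrow> survival (off_diag n) (pair_gen n E r) t p \<le> c"
  shows "mixed_within (config_space n m) (BB_gen E r s) t (real m * c)"
  unfolding mixed_within_def
proof (intro ballI)
  fix \<xi> \<eta> assume states: "\<xi> \<in> config_space n m" "\<eta> \<in> config_space n m"
  let ?d = "\<lambda>\<xi> \<eta>. tv_dist (config_space n m) (expm (config_space n m) (BB_gen E r s) t \<xi>)
      (expm (config_space n m) (BB_gen E r s) t \<eta>)"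
  have "(1, 2) \<in> off_diag n" using n_ge_2 by (simp add: off_diag_def)
  from uniformized.survival_pos[OF uniformized_pair this assms(1)] tail[OF this] have "0 \<le> c" by linarith
  show "?d \<xi> \<eta> \<le> real m * c"
  proof (rule relpow_bound[OF _ tv_dist_triangle _ config_space_relpow_one_move[OF states]])
    fix \<alpha> \<beta> assume "(\<alpha>, \<beta>) \<in> one_move n m"
    then consider (equal) "\<alpha> = \<beta>" | (adjacent) p where "(\<alpha>, \<beta>, p) \<in> adjacent n m"
      by (auto simp: one_move_def)
    then show "?d \<alpha> \<beta> \<le> c"
    proof cases
      case equal
      then show ?thesis using \<open>0 \<le> c\<close> by (simp add: tv_dist_self)
    next
      case (adjacent p)
      have "?d \<alpha> \<beta> \<le> survival (off_diag n) (pair_gen n E r) t p"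
        by (rule tv_dist_le_survival[OF uniformized_bb uniformized_pair bb_kernel_contraction
              adjacent_states adjacent assms(1)])
      also have "\<dots> \<le> c" using adjacent_states[OF adjacent] by (intro tail) simp
      finally show ?thesis .
    qed
  qed (simp add: tv_dist_self)
qed

lemma tmix_BB_le:
  assumes lifetime: "\<And>p. p \<in> off_diag n \<Longrightarrow> mean_lifetime (off_diag n) (pair_gen n E r) p \<le> ennreal M"
    and "0 \<le> M" and m_pos: "0 < m" and \<epsilon>_pos: "0 < \<epsilon>" and k_ge: "ln (real m / \<epsilon>) \<le> real k"
  shows "tmix_BB n E r s m \<epsilon> \<le> real k * (exp 1 * M)"
proof -
  let ?T = "\<lambda>k. real k * (exp 1 * M)" and ?S = "config_space n m" and ?Q = "BB_gen E r s"
  have mixed: "mixed_within ?S ?Q (?T k) (real m * exp (- 1) ^ k)" for k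
    by (rule mixed_within_if_survival_le)
       (use uniformized.survival_exp_decay[OF uniformized_pair lifetime] assms(2) in auto)
  have "(\<lambda>k. real m * exp (- 1) ^ k) \<longlonglongrightarrow> 0"
    by (intro tendsto_mult_right_zero LIMSEQ_realpow_zero) simp_all
  moreover have "mixed_within ?S ?Q (?T k) \<epsilon>"
  proof -
    have "real m * exp (- 1) ^ k = real m * exp (- real k)" by (simp flip: exp_of_nat_mult)
    also have "\<dots> \<le> real m * exp (- ln (real m / \<epsilon>))" using k_ge by (intro mult_left_mono) simp_all
    also have "\<dots> = \<epsilon>" using m_pos \<epsilon>_pos by (simp add: exp_minus)
    finally show ?thesis using mixed[of k] unfolding mixed_within_def by fastforce
  qed
  moreover obtain \<pi> where "is_stationary ?S ?Q \<pi>" using stationary_exists by blast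
  ultimately show ?thesis
    unfolding tmix_BB_def using assms(2) mixed
    by (intro tmix_le_if_mixed_within[OF finite_config_space]) auto
qed

end

section \<open>The mixing bound\<close>

lemma ln_div_ge_1:
  fixes x \<epsilon> :: real
  assumes "1 \<le> x" "0 < \<epsilon>" "\<epsilon> < 1 / 4"
  shows "1 \<le> ln (x / \<epsilon>)"
proof -
  have "4 \<le> x / \<epsilon>" using assms by (simp add: le_divide_eq)
  then show ?thesis using exp_le by (subst ln_ge_iff) linarith+
qed

lemma (in bb_graph) tmix_BB_le_ln:
  assumes "\<And>p. p \<in> off_diag n \<Longrightarrow> mean_lifetime (off_diag n) (pair_gen n E r) p \<le> ennreal M"
    and M_nonneg: "0 \<le> M" and m_ge_1: "1 \<le> m" and \<epsilon>_bounds: "0 < \<epsilon>" "\<epsilon> < 1 / 4"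
  shows "tmix_BB n E r s m \<epsilon> \<le> 2 * exp 1 * ln ((real n + real m) / \<epsilon>) * M"
proof -
  let ?L = "ln (real m / \<epsilon>)"
  have L_ge_1: "1 \<le> ?L" using m_ge_1 \<epsilon>_bounds by (intro ln_div_ge_1) auto
  define k where "k = nat \<lceil>?L\<rceil>"
  have k_bounds: "?L \<le> real k" "real k \<le> ?L + 1" using L_ge_1 by (auto simp: k_def of_nat_ceiling)
  have "tmix_BB n E r s m \<epsilon> \<le> real k * (exp 1 * M)"
    using assms k_bounds(1) by (intro tmix_BB_le) auto
  also have "\<dots> \<le> (2 * ?L) * (exp 1 * M)"
    using k_bounds(2) L_ge_1 M_nonneg by (intro mult_right_mono) auto
  also have "\<dots> \<le> (2 * ln ((real n + real m) / \<epsilon>)) * (exp 1 * M)"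
    using m_ge_1 \<epsilon>_bounds M_nonneg
    by (intro mult_right_mono mult_left_mono ln_mono divide_right_mono) auto
  finally show ?thesis by (simp add: mult_ac)
qed

lemma tmix_BB_le_0:
  assumes graph: "weighted_conn_graph n E r" and n_less_2: "n < 2" and "0 \<le> \<epsilon>"
  shows "tmix_BB n E r s m \<epsilon> \<le> 0"
proof -
  have "E = {}"
  proof (rule ccontr)
    assume "E \<noteq> {}"
    then obtain e where "e \<subseteq> {1..n}" "card e = 2"
      using graph by (auto simp: weighted_conn_graph_def)
    then have "2 \<le> card {1..n}" by (metis card_mono finite_atLeastAtMost)
    then show False using n_less_2 by simp
  qed
  then have BB_gen_eq_0: "BB_gen E r s \<xi> \<eta> = 0" for \<xi> \<eta> by (simp add: BB_gen_def)
  consider "config_space n m = {}" | \<xi> where "config_space n m = {\<xi>}"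
    using config_space_subsingleton[OF n_less_2] by (metis is_singletonI' is_singleton_the_elem)
  then show ?thesis
    unfolding tmix_BB_def
    by cases (auto intro: tmix_le_if_tv_dist_equilibrium_le
        simp: tmix_singleton_le BB_gen_eq_0 assms(3))
qed

theorem BB_mixing_bound_universal:
  assumes "0 < s" "2 * exp 1 \<le> C"
  shows "BB_mixing_bound s C"
  unfolding BB_mixing_bound_def
proof (intro allI impI)
  fix n m :: nat and E :: "nat set set" and r :: "nat set \<Rightarrow> real" and \<epsilon> :: real
  assume graph: "weighted_conn_graph n E r" and m_ge_2: "2 \<le> m" and \<epsilon>_bounds: "0 < \<epsilon>" "\<epsilon> < 1 / 4"
  let ?L = "ln ((real n + real m) / \<epsilon>)"
  have L_ge_1: "1 \<le> ?L" using m_ge_2 \<epsilon>_bounds by (intro ln_div_ge_1) auto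
  have C_pos: "0 < C" using assms(2) exp_gt_zero[of "1::real"] by linarith
  consider (small) "n < 2" | (infinite) "2 \<le> n" "max_exp_meet n E r = top"
    | (finite) M where "2 \<le> n" "max_exp_meet n E r = ennreal M" "0 \<le> M"
    by (cases "max_exp_meet n E r") fastforce+
  then show "ennreal (tmix_BB n E r s m \<epsilon>) \<le> ennreal (C * ?L) * max_exp_meet n E r"
  proof cases
    case small
    \<comment> \<open>There are no distinct vertices: the right-hand side is 0, a supremum over the empty set.\<close>
    then show ?thesis using tmix_BB_le_0[OF graph, of \<epsilon> s m] \<epsilon>_bounds by (simp add: ennreal_neg)
  next
    case infinite
    then show ?thesis using C_pos L_ge_1 by (simp add: ennreal_mult_top)
  next
    case (finite M)
    interpret bb_graph n E r s using graph finite(1) assms(1) by unfold_locales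
    have "tmix_BB n E r s m \<epsilon> \<le> 2 * exp 1 * ?L * M"
      using mean_lifetime_le_max_exp_meet[of _ n E r] finite(3) m_ge_2 \<epsilon>_bounds
      by (intro tmix_BB_le_ln) (simp_all add: finite(2))
    also have "\<dots> \<le> C * ?L * M"
      using assms(2) L_ge_1 finite(3) by (intro mult_right_mono) auto
    finally have "ennreal (tmix_BB n E r s m \<epsilon>) \<le> ennreal (C * ?L * M)" by (rule ennreal_leI)
    also have "\<dots> = ennreal (C * ?L) * max_exp_meet n E r"
      using C_pos L_ge_1 finite(3) by (simp add: finite(2) ennreal_mult)
    finally show ?thesis .
  qed
qed

section \<open>The explicit constant\<close>

lemma Beta_real_lower_bound:
  fixes a b \<delta> :: real
  assumes "0 < a" "0 < b" "0 < \<delta>" "\<delta> \<le> 1 / 2"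
  shows "\<delta> powr (a + b) * (1 - 2 * \<delta>) \<le> Beta a b"
proof -
  let ?f = "\<lambda>t. t powr (a - 1) * (1 - t) powr (b - 1)"
  have Beta_integral: "(?f has_integral Beta a b) {0..1}"
    by (rule has_integral_Beta_real[OF assms(1,2)])
  have integrable: "?f integrable_on {\<delta>..1 - \<delta>}"
    by (rule integrable_on_subinterval[OF has_integral_integrable[OF Beta_integral]])
       (use assms in auto)
  have powr_ge: "\<delta> powr c \<le> x powr (c - 1)" if "\<delta> \<le> x" "x \<le> 1" "0 < c" for x c :: real
  proof -
    have "\<delta> powr c \<le> x powr c" using that assms by (intro powr_mono2) auto
    also have "\<dots> \<le> x powr (c - 1)" using that assms by (intro powr_mono') auto
    finally show ?thesis .
  qed
  have "\<delta> powr (a + b) * (1 - 2 * \<delta>) = integral {\<delta>..1 - \<delta>} (\<lambda>_. \<delta> powr (a + b))"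
    using assms by simp
  also have "\<dots> \<le> integral {\<delta>..1 - \<delta>} ?f"
  proof (rule integral_le[OF integrable_const_ivl integrable])
    fix t assume "t \<in> {\<delta>..1 - \<delta>}"
    then show "\<delta> powr (a + b) \<le> ?f t"
      unfolding powr_add using assms by (intro mult_mono powr_ge) auto
  qed
  also have "\<dots> \<le> integral {0..1} ?f"
    by (rule integral_subset_le[OF _ integrable has_integral_integrable[OF Beta_integral]])
       (use assms in auto)
  also have "\<dots> = Beta a b" using Beta_integral by (rule integral_unique)
  finally show ?thesis .
qed

lemma p_star_pos: "0 < s \<Longrightarrow> 0 < p_star s"
  using Beta_real_pos[of s s] by (auto simp: p_star_def)

lemma p_star_le_1:
  assumes "0 < s"
  shows "p_star s \<le> 1"
proof -
  have "(5/12) powr (2 * s) \<le> 6 * Beta s s"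
    using Beta_real_lower_bound[OF assms assms, of "5/12"] by simp
  then show ?thesis
    using assms Beta_real_pos[OF assms assms] by (auto simp: p_star_def divide_simps)
qed

lemma C_of_ge:
  assumes "0 < a" "0 < b" "0 < s" "0 \<le> C'"
  shows "C' / 2 \<le> C_of C' a b s"
proof -
  let ?P = "p_star s powr (-2)"
  have "1 \<le> ?P"
    using p_star_pos[OF assms(3)] p_star_le_1[OF assms(3)] powr_mono'[of "-2" 0 "p_star s"] by simp
  then have aP_ge_1: "1 \<le> real a * ?P"
    using mult_mono[of 1 "real a" 1 ?P] assms(1) by simp
  then have ln_aP_ge_1: "1 \<le> ln (12 * real a * ?P)"
    using exp_le by (subst ln_ge_iff) (simp_all add: mult.assoc)
  have "ln 2 \<le> ln (real a + real b)" using assms by (intro ln_mono) auto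
  then have ln_ab_ge_half: "1 / 2 \<le> ln (real a + real b)" using ln2_ge_two_thirds by linarith
  have "C' * (1 * 1 * (1 / 2)) \<le> C' * (real a * ?P * ln (12 * real a * ?P) * ln (real a + real b))"
    using aP_ge_1 ln_aP_ge_1 ln_ab_ge_half assms(4) by (intro mult_left_mono mult_mono) auto
  then show ?thesis by (simp add: C_of_def mult_ac)
qed

theorem theorem1:
  shows "(\<forall>s::real. s \<in> \<rat> \<longrightarrow> s > 0 \<longrightarrow> (\<exists>C>0. BB_mixing_bound s C))
       \<and> (\<exists>C'>0. \<forall>(a::nat) (b::nat) (s::real). a > 0 \<longrightarrow> b > 0 \<longrightarrow> coprime a b \<longrightarrow>
             s = real b / real a \<longrightarrow> BB_mixing_bound s (C_of C' a b s))"
proof (intro conjI allI impI)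
  fix s :: real assume "0 < s"
  then have "BB_mixing_bound s (2 * exp 1)" by (rule BB_mixing_bound_universal) simp
  then show "\<exists>C>0. BB_mixing_bound s C" by (intro exI[of _ "2 * exp 1"]) simp
next
  have "BB_mixing_bound s (C_of (4 * exp 1) a b s)"
    if "0 < a" "0 < b" "s = real b / real a" for a b :: nat and s :: real
    using that C_of_ge[of a b s "4 * exp 1"] by (intro BB_mixing_bound_universal) auto
  then show "\<exists>C'>0. \<forall>(a::nat) (b::nat) (s::real). a > 0 \<longrightarrow> b > 0 \<longrightarrow> coprime a b \<longrightarrow>
             s = real b / real a \<longrightarrow> BB_mixing_bound s (C_of C' a b s)"
    by (intro exI[of _ "4 * exp 1"]) auto
qed

end
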